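(* Let $f\in\mathcal{H}^1$. For $(w,p)\in\mathcal{O}\times\mathcal{H}^{1,+}_0$ put $H_f(w,p)=\langle w,p^2\rangle+\int_0^1\frac{f(y)}{w(y)}\,dy$ and, for $k\ge1$, $J^f_k(w,p)=I_k(w,p)+U^f_k(w)$, where $I_k(w,p)=\langle A_k(w)\Gamma(w)p,p\rangle$ and $U^f_k(w)=-\big(w\,\Pi^+_0(f/w)\big)_{k+1}$. Then: (i) the functions $J^f_k:\mathcal{O}\times\mathcal{H}^{1,+}_0\to\mathbb{C}$, $k\ge1$, are analytic integrals of the Hamiltonian flow of $H_f$ (i.e. each $J^f_k$ is analytic and $\{H_f,J_k^f\}=0$); (ii) $\{J^f_k,J^f_l\}=0$ for any $k,l\ge1$.
   Context: All spaces are complex, and "analytic" means complex-analytic between (open subsets of) complex Banach spaces. $\mathbb{T}=\mathbb{R}/\mathbb{Z}$, $f_k=(f)_k=\int_0^1 f(y)e^{-2\pi i k y}\,dy$ are Fourier coefficients, $\langle k\rangle:=|k|$ for $k\neq0$, $\langle0\rangle:=1$. $\mathcal{H}^1$ is the Hilbert space of functions $f:\mathbb{T}\to\mathbb{C}$ with $\|f\|_{\mathcal{H}^1}=(\sum_{k\in\mathbb{Z}}|f_k|^2\langle k\rangle^2)^{1/2}<\infty$ (a Banach algebra under pointwise multiplication). $\mathcal{H}^{1,+}=\{f\in\mathcal{H}^1: f_k=0 \text{ for } k<0\}$, $\mathcal{H}^{1,+}_0=\{f\in\mathcal{H}^1: f_k=0\text{ for }k\le 0\}$, and $\Pi^+,\Pi^+_0$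 are the corresponding Fourier-truncation projections of $\mathcal{H}^1$ onto these subspaces. The bilinear pairing is $\langle f,g\rangle=\sum_{k\in\mathbb{Z}}f_kg_k$, and $\check f(y):=f(-y)$. $\mathcal{O}:=\{w\in\mathcal{H}^{1,+}_0: w(y)\ne0\ \forall y\in\mathbb{T}\}$, an open dense subset of $\mathcal{H}^{1,+}_0$; for $w\in\mathcal{O}$ one has $1/w\in\mathcal{H}^1$. Shift: $(Lf)(y)=f(y)e^{-2\pi i y}$. For $w\in\mathcal{H}^{1,+}_0$ and $k\ge1$, $A_k(w):\mathcal{H}^{1,+}_0\to\mathcal{H}^{1,+}_0$ is the bounded operator $A_k(w)g=g\,\Pi^+(L^{k+1}w)-w\,\Pi^+(L^{k+1}g)$. The Hankel operator is $\Gamma(w)p=\Pi^+_0(w\check p)$ on $\mathcal{H}^{1,+}_0$. Poisson bracket: for a $C^1$ function $F$ on $\mathcal{O}\times\mathcal{H}^{1,+}_0$ the gradients $\nabla_wF,\nabla_pF$ are the distributions on $\mathbb{T}$ with Fourier coefficients vanishing for $k\le0$ determined by $\langle\nabla_wF,\delta w\rangle=(D_1F)(\delta w)$, $\langle\nabla_pF,\delta p\rangle=(D_2F)(\delta p)$ for all $\delta w,\delta p\in\mathcal{H}^{1,+}_0$, where $D_1,D_2$ are the partial differentials in $w$ and $p$. The Hamiltonian vector field is $X_F=(\nabla_pF,-\nabla_wF)$ and $\{F,G\}=dG(X_F)=\langle\nabla_pF,\nabla_wG\rangle-\langle\nabla_wF,\nabla_pG\rangle$ (whenever this is defined). The Hamiltonian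 equation of $F$ is $(\dot w,\dot p)=X_F(w,p)$. *)

theory Defs
  imports "HOL-Analysis.Analysis"
begin

subsection \<open>The space of functions on the torus\<close>

definition fourier_coeff :: "(real \<Rightarrow> complex) \<Rightarrow> int \<Rightarrow> complex" where
  "fourier_coeff f k = integral {0..1} (\<lambda>y. f y * cis (- (2 * pi * of_int k * y)))"

definition weight :: "int \<Rightarrow> real" where
  "weight k = (if k = 0 then 1 else \<bar>of_int k\<bar>)"

text \<open>
  A function on the torus is a 1-periodic function on the real line. Elements of \<open>\<H>\<^sup>1\<close> are
  a priori classes modulo null sets; finiteness of the norm makes the Fourier series absolutely
  convergent, and \<open>H1\<close> contains the continuous representative of each class.
\<close>

definition H1 :: "(real \<Rightarrow> complex) set" where
  "H1 = {f. continuous_on UNIV f \<and> (\<forall>y. f (y + 1) = f y) \<and>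
            (\<lambda>k. (cmod (fourier_coeff f k))\<^sup>2 * (weight k)\<^sup>2) summable_on UNIV}"

definition H1_norm :: "(real \<Rightarrow> complex) \<Rightarrow> real" where
  "H1_norm f = sqrt (\<Sum>\<^sub>\<infinity>k. (cmod (fourier_coeff f k))\<^sup>2 * (weight k)\<^sup>2)"

subsection \<open>Fourier uniqueness\<close>

lemma weight_ge_1: "weight k \<ge> 1"
  unfolding weight_def by (auto simp flip: of_int_abs)

lemma cis_integrable:
  assumes "continuous_on UNIV f"
  shows "(\<lambda>y. f y * cis (c * y)) integrable_on {0..1::real}"
  by (rule integrable_continuous_real) (intro continuous_intros continuous_on_subset[OF assms], auto)

lemma fourier_coeff_alt:
  "fourier_coeff f k = integral {0..1} (\<lambda>y. f y * cis ((- (2 * pi * of_int k)) * y))"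
  unfolding fourier_coeff_def by simp

lemma fourier_coeff_add:
  assumes "continuous_on UNIV f" "continuous_on UNIV g"
  shows "fourier_coeff (\<lambda>y. f y + g y) k = fourier_coeff f k + fourier_coeff g k"
  unfolding fourier_coeff_alt
  unfolding distrib_right
  by (rule integral_add[OF cis_integrable[OF assms(1)] cis_integrable[OF assms(2)]])

lemma fourier_coeff_cmult:
  "fourier_coeff (\<lambda>y. c * f y) k = c * fourier_coeff f k"
  unfolding fourier_coeff_def by (simp add: mult.assoc)

lemma fourier_coeff_zero [simp]: "fourier_coeff (\<lambda>y. 0) k = 0"
  unfolding fourier_coeff_def by simp

lemma periodic_shift_int:
  assumes "\<And>y::real. f (y + 1) = f y"
  shows "f (y + of_int n) = f y"
proof -
  have nat: "f (y + real m) = f y" for y m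
  proof (induction m)
    case (Suc m)
    have "f (y + real (Suc m)) = f ((y + real m) + 1)" by (simp add: algebra_simps)
    then show ?case using assms Suc by simp
  qed simp
  show ?thesis
  proof (cases "n \<ge> 0")
    case True
    then show ?thesis using nat[of y "nat n"] by simp
  next
    case False
    then show ?thesis using nat[of "y + of_int n" "nat (-n)"] by simp
  qed
qed

lemma has_integral_cis:
  "((\<lambda>y. cis (2 * pi * of_int n * y)) has_integral (if n = 0 then 1 else 0)) {0..1::real}"
proof (cases "n = 0")
  case True
  then show ?thesis using has_integral_const_real[of "1::complex" 0 1] by simp
next
  case False
  define a where "a = 2 * pi * real_of_int n"
  have a0: "a \<noteq> 0" using False by (simp add: a_def)
  define F where "F y = cis (a * y) / (\<i> * of_real a)" for y
  have d: "(F has_vector_derivative cis (a * y)) (at y within {0..1})" for y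
  proof -
    have "((\<lambda>z. exp (\<i> * of_real a * z) / (\<i> * of_real a)) has_field_derivative exp (\<i> * of_real a * of_real y))
        (at (of_real y))"
      using a0 by (auto intro!: derivative_eq_intros)
    from has_vector_derivative_real_field[OF this]
    show ?thesis
      unfolding F_def by (simp add: cis_conv_exp mult_ac)
  qed
  have "((\<lambda>y. cis (a * y)) has_integral (F 1 - F 0)) {0..1}"
    by (rule fundamental_theorem_of_calculus) (use d in auto)
  moreover have "F 1 = F 0"
  proof -
    have "cis (2 * pi * real_of_int n) = 1"
      by (rule cis_multiple_2pi) simp
    then show ?thesis by (simp add: F_def a_def)
  qed
  ultimately show ?thesis using False by (simp add: a_def)
qed

lemma fourier_coeff_character:
  "fourier_coeff (\<lambda>y. cis (2 * pi * of_int m * y)) k = (if m = k then 1 else 0)"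
proof -
  have "(\<lambda>y. cis (2 * pi * of_int m * y) * cis (- (2 * pi * of_int k * y)))
      = (\<lambda>y. cis (2 * pi * of_int (m - k) * y))"
    by (auto simp: cis_mult algebra_simps)
  then show ?thesis
    unfolding fourier_coeff_def using has_integral_cis[of "m - k"] by (simp add: integral_unique)
qed

text \<open>A property stable under multiplication by trigonometric polynomials.\<close>

definition coeff_null :: "(real \<Rightarrow> complex) \<Rightarrow> bool" where
  "coeff_null h \<longleftrightarrow> continuous_on UNIV h \<and> (\<forall>k. fourier_coeff h k = 0)"

lemma coeff_null_character:
  assumes "coeff_null h"
  shows "coeff_null (\<lambda>y. h y * cis (2 * pi * of_int m * y))"
proof -
  have "fourier_coeff (\<lambda>y. h y * cis (2 * pi * of_int m * y)) k = fourier_coeff h (k - m)" for k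
    unfolding fourier_coeff_def
    by (rule arg_cong[where f = "integral {0..1}"]) (auto simp: cis_mult mult.assoc algebra_simps)
  then show ?thesis using assms unfolding coeff_null_def by (auto intro!: continuous_intros)
qed

lemma coeff_null_add: "coeff_null g \<Longrightarrow> coeff_null h \<Longrightarrow> coeff_null (\<lambda>y. g y + h y)"
  unfolding coeff_null_def by (auto simp: fourier_coeff_add intro!: continuous_intros)

lemma coeff_null_cmult: "coeff_null h \<Longrightarrow> coeff_null (\<lambda>y. c * h y)"
  unfolding coeff_null_def by (auto simp: fourier_coeff_cmult intro!: continuous_intros)

lemma coeff_null_poly:
  fixes g :: "complex \<Rightarrow> real"
  assumes "real_polynomial_function g" "coeff_null h"
  shows "coeff_null (\<lambda>y. h y * of_real (g (cis (2 * pi * y))))"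
  using assms
proof (induction arbitrary: h rule: real_polynomial_function.induct)
  case (linear f)
  define a where "a = f 1"
  define b where "b = f \<i>"
  have lin: "f z = a * Re z + b * Im z" for z
  proof -
    interpret bounded_linear f by fact
    have "f z = f (Re z *\<^sub>R 1 + Im z *\<^sub>R \<i>)"
      by (rule arg_cong[where f = f]) (simp add: complex_eq_iff)
    then show ?thesis by (simp only: add scaleR a_def b_def) simp
  qed
  have eq: "h y * of_real (f (cis (2 * pi * y))) =
      ((of_real a - \<i> * of_real b) / 2) * (h y * cis (2 * pi * of_int 1 * y)) +
      ((of_real a + \<i> * of_real b) / 2) * (h y * cis (2 * pi * of_int (-1) * y))" for y
    unfolding lin by (simp add: complex_eq_iff field_simps)
  show ?case unfolding eq
    by (intro coeff_null_add coeff_null_cmult coeff_null_character linear)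
next
  case (const c)
  then show ?case using coeff_null_cmult[of h "of_real c"] by (simp add: mult.commute)
next
  case (add f g)
  then show ?case using coeff_null_add[OF add.IH(1)[OF add.prems] add.IH(2)[OF add.prems]]
    by (simp add: algebra_simps)
next
  case (mult f g)
  from mult.IH(2)[OF mult.IH(1)[OF mult.prems]] show ?case by (simp add: mult.assoc)
qed

lemma periodic_factor:
  fixes u :: "real \<Rightarrow> real"
  assumes cont: "continuous_on UNIV u" and per: "\<And>y. u (y + 1) = u y"
  obtains h :: "complex \<Rightarrow> real"
  where "continuous_on (sphere 0 1) h" "\<And>y. h (cis (2 * pi * y)) = u y"
proof -
  define q where "q y = cis (2 * pi * y)" for y
  define h where "h z = u (SOME y. q y = z)" for z
  have hq: "h (q y) = u y" for y
  proof -
    define y' where "y' = (SOME y'. q y' = q y)"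
    have "q y' = q y" unfolding y'_def by (rule someI) simp
    then have "sin (2 * pi * y') = sin (2 * pi * y) \<and> cos (2 * pi * y') = cos (2 * pi * y)"
      by (simp add: q_def complex_eq_iff)
    then obtain n :: int where "2 * pi * y' = 2 * pi * y + 2 * pi * n"
      unfolding sin_cos_eq_iff by blast
    then have "2 * pi * y' = 2 * pi * (y + n)" by (simp add: algebra_simps)
    then have "y' = y + of_int n" by simp
    then show ?thesis
      unfolding h_def y'_def[symmetric] using periodic_shift_int[of u, OF per] by simp
  qed
  have surj: "\<exists>y\<in>{0..1}. q y = z" if "z \<in> sphere 0 1" for z
  proof -
    from that have z: "norm z = 1" by simp
    obtain t where t: "0 \<le> t" "t < 2 * pi" "z = cis t"
    proof -
      have "z = of_real (norm z) * exp (\<i> * of_real (Arg2pi z))" "0 \<le> Arg2pi z" "Arg2pi z < 2 * pi"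
        using Arg2pi[of z] by (auto simp: is_Arg_def)
      with z that show ?thesis by (metis cis_conv_exp mult_1 of_real_1)
    qed
    show ?thesis
      by (rule bexI[of _ "t / (2 * pi)"]) (use t in \<open>auto simp: q_def\<close>)
  qed
  have "continuous_on (sphere 0 1) h"
    unfolding continuous_on_closed_vimage[OF closed_sphere]
  proof (intro allI impI)
    fix C :: "real set" assume C: "closed C"
    have E: "h -` C \<inter> sphere 0 1 = q ` ({0..1} \<inter> u -` C)"
    proof (intro equalityI subsetI)
      fix z assume "z \<in> h -` C \<inter> sphere 0 1"
      with surj[of z] obtain y where "y \<in> {0..1}" "q y = z" "h z \<in> C" by auto
      then show "z \<in> q ` ({0..1} \<inter> u -` C)" using hq by auto
    next
      fix z assume "z \<in> q ` ({0..1} \<inter> u -` C)"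
      then show "z \<in> h -` C \<inter> sphere 0 1" using hq by (auto simp: q_def)
    qed
    have K: "compact ({0..1} \<inter> u -` C)"
      using continuous_closed_vimage[OF C, of u] cont
      by (auto intro!: compact_Int_closed simp: continuous_on_eq_continuous_at)
    have q: "continuous_on S q" for S
      unfolding q_def by (intro continuous_intros)
    show "closed (h -` C \<inter> sphere 0 1)"
      unfolding E by (intro compact_imp_closed compact_continuous_image q K)
  qed
  with hq that show ?thesis unfolding q_def by blast
qed

lemma fourier_unique:
  assumes cont: "continuous_on UNIV f" and per: "\<And>y. f (y + 1) = f y"
    and null: "\<And>k. fourier_coeff f k = 0"
  shows "f = (\<lambda>y. 0)"
proof -
  have cRe: "continuous_on UNIV (\<lambda>y. Re (f y))" and cIm: "continuous_on UNIV (\<lambda>y. Im (f y))"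
    using cont by (auto intro!: continuous_intros)
  obtain hr where hr: "continuous_on (sphere 0 1) hr" "\<And>y. hr (cis (2 * pi * y)) = Re (f y)"
    by (rule periodic_factor[OF cRe]) (auto simp: per)
  obtain hi where hi: "continuous_on (sphere 0 1) hi" "\<And>y. hi (cis (2 * pi * y)) = Im (f y)"
    by (rule periodic_factor[OF cIm]) (auto simp: per)
  have c01: "continuous_on {0..1} f" using cont continuous_on_subset by blast
  have "compact (f ` {0..1})" using c01 by (intro compact_continuous_image) auto
  then obtain M where M: "M > 0" "\<And>y. y \<in> {0..1} \<Longrightarrow> cmod (f y) \<le> M"
    using compact_imp_bounded bounded_pos by (metis imageI)
  have small: "norm (integral {0..1} (\<lambda>y. f y * cnj (f y))) \<le> M * (2 * e)" if e: "e > 0" for e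
  proof -
    obtain gr where gr: "real_polynomial_function gr" "\<And>x. x \<in> sphere 0 1 \<Longrightarrow> \<bar>hr x - gr x\<bar> < e"
      using Stone_Weierstrass_real_polynomial_function[OF compact_sphere hr(1) e] by blast
    obtain gi where gi: "real_polynomial_function gi" "\<And>x. x \<in> sphere 0 1 \<Longrightarrow> \<bar>hi x - gi x\<bar> < e"
      using Stone_Weierstrass_real_polynomial_function[OF compact_sphere hi(1) e] by blast
    define G where "G y = of_real (gr (cis (2 * pi * y))) - \<i> * of_real (gi (cis (2 * pi * y)))" for y
    have nf: "coeff_null f" using cont null by (simp add: coeff_null_def)
    have "coeff_null (\<lambda>y. f y * of_real (gr (cis (2 * pi * y))) + (- \<i>) * (f y * of_real (gi (cis (2 * pi * y)))))"
      by (intro coeff_null_add coeff_null_cmult coeff_null_poly gr gi nf)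
    then have nG: "coeff_null (\<lambda>y. f y * G y)"
      by (simp add: G_def algebra_simps)
    then have G0: "integral {0..1} (\<lambda>y. f y * G y) = 0"
      unfolding coeff_null_def by (auto simp: fourier_coeff_def dest!: spec[of _ 0])
    have cG: "continuous_on {0..1} (\<lambda>y. f y * G y)"
      using nG unfolding coeff_null_def by (metis continuous_on_subset subset_UNIV)
    have cc: "continuous_on {0..1} (\<lambda>y. f y * cnj (f y))"
      using c01 by (intro continuous_intros)
    have "integral {0..1} (\<lambda>y. f y * cnj (f y)) = integral {0..1} (\<lambda>y. f y * cnj (f y) - f y * G y)"
      using G0 by (subst integral_diff) (auto intro!: integrable_continuous_real cG cc)
    also have "norm \<dots> \<le> M * (2 * e) * (1 - 0)"
    proof (rule integral_bound)
      show "continuous_on {0..1} (\<lambda>y. f y * cnj (f y) - f y * G y)"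
        by (intro continuous_intros cG cc)
      fix y :: real assume y: "y \<in> {0..1}"
      have "cmod (cnj (f y) - G y) \<le> \<bar>Re (cnj (f y) - G y)\<bar> + \<bar>Im (cnj (f y) - G y)\<bar>"
        by (rule cmod_le)
      also have "\<dots> \<le> 2 * e"
        using gr(2)[of "cis (2 * pi * y)"] gi(2)[of "cis (2 * pi * y)"] hr(2)[of y] hi(2)[of y]
        by (simp add: G_def)
      finally have "cmod (f y) * cmod (cnj (f y) - G y) \<le> M * (2 * e)"
        using M y by (intro mult_mono) auto
      then show "norm (f y * cnj (f y) - f y * G y) \<le> M * (2 * e)"
        by (simp add: norm_mult flip: right_diff_distrib)
    qed auto
    finally show ?thesis by simp
  qed
  have "norm (integral {0..1} (\<lambda>y. f y * cnj (f y))) \<le> 0 + e" if "e > 0" for e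
    using small[of "e / (2 * M)"] M(1) that by simp
  then have "integral {0..1} (\<lambda>y. f y * cnj (f y)) = 0"
    by (metis field_le_epsilon norm_le_zero_iff)
  moreover have "integral {0..1} (\<lambda>y. f y * cnj (f y)) = of_real (integral {0..1} (\<lambda>y. (cmod (f y))\<^sup>2))"
  proof -
    have i: "(\<lambda>y. (cmod (f y))\<^sup>2) integrable_on {0..1}"
      by (rule integrable_continuous_real) (intro continuous_intros c01)
    have "(\<lambda>y. f y * cnj (f y)) = complex_of_real \<circ> (\<lambda>y. (cmod (f y))\<^sup>2)"
      unfolding o_def complex_norm_square ..
    then show ?thesis
      using integral_linear[OF i bounded_linear_of_real] by (simp only:)
  qed
  ultimately have i0: "integral {0..1} (\<lambda>y. (cmod (f y))\<^sup>2) = 0" by (metis of_real_eq_0_iff)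
  then have z: "f y = 0" if "y \<in> {0..1}" for y
  proof -
    have "continuous_on {0..1} (\<lambda>y. (cmod (f y))\<^sup>2)" by (intro continuous_intros c01)
    then have "integral {0..1} (\<lambda>y. (cmod (f y))\<^sup>2) = 0 \<longleftrightarrow> (\<forall>y\<in>{0..1}. (cmod (f y))\<^sup>2 = 0)"
      by (rule integral_eq_0_iff) auto
    with i0 that show ?thesis by simp
  qed
  have "f y = 0" for y
  proof -
    have "f y = f (frac y + of_int \<lfloor>y\<rfloor>)" by (simp add: frac_def)
    also have "\<dots> = f (frac y)" by (rule periodic_shift_int) (rule per)
    also have "\<dots> = 0" using frac_lt_1[of y] by (intro z) (auto simp: less_imp_le)
    finally show ?thesis .
  qed
  then show ?thesis by auto
qed


subsection \<open>Fourier series with square-summable weighted coefficients\<close>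

lemma summable_inverse_weight: "(\<lambda>k. 1 / (weight k)\<^sup>2) summable_on UNIV"
proof -
  have nat: "(\<lambda>n. 1 / (real (Suc n))\<^sup>2) summable_on UNIV"
    using inverse_squares_sums by (intro summable_nonneg_imp_summable_on) (auto simp: sums_iff add.commute)
  have eq: "(\<lambda>k. 1 / (weight k)\<^sup>2) \<circ> (\<lambda>n. int (Suc n)) = (\<lambda>n. 1 / (real (Suc n))\<^sup>2)"
    "(\<lambda>k. 1 / (weight k)\<^sup>2) \<circ> (\<lambda>n. - int (Suc n)) = (\<lambda>n. 1 / (real (Suc n))\<^sup>2)"
    by (auto simp: weight_def fun_eq_iff abs_if)
  have "(\<lambda>k. 1 / (weight k)\<^sup>2) summable_on range (\<lambda>n. int (Suc n))"
    by (subst summable_on_reindex) (use nat in \<open>simp_all only: eq\<close>, auto simp: inj_on_def)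
  moreover have "(\<lambda>k. 1 / (weight k)\<^sup>2) summable_on range (\<lambda>n. - int (Suc n))"
    by (subst summable_on_reindex) (use nat in \<open>simp_all only: eq\<close>, auto simp: inj_on_def)
  ultimately have "(\<lambda>k. 1 / (weight k)\<^sup>2) summable_on (range (\<lambda>n. int (Suc n)) \<union> range (\<lambda>n. - int (Suc n)))"
    by (rule summable_on_Un_disjoint) auto
  then have "(\<lambda>k. 1 / (weight k)\<^sup>2) summable_on (range (\<lambda>n. int (Suc n)) \<union> range (\<lambda>n. - int (Suc n)) \<union> {0})"
    by (rule summable_on_Un_disjoint) auto
  moreover have "range (\<lambda>n. int (Suc n)) \<union> range (\<lambda>n. - int (Suc n)) \<union> {0} = UNIV"
  proof -
    have "k \<in> range (\<lambda>n. int (Suc n)) \<union> range (\<lambda>n. - int (Suc n)) \<union> {0}" for k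
    proof -
      consider "k > 0" | "k = 0" | "k < 0" by linarith
      then show ?thesis
      proof cases
        case 1
        then have "k = int (Suc (nat (k - 1)))" by simp
        then show ?thesis by blast
      next
        case 3
        then have "k = - int (Suc (nat (- k - 1)))" by simp
        then show ?thesis by blast
      qed simp
    qed
    then show ?thesis by blast
  qed
  ultimately show ?thesis by simp
qed

definition weighted_l2 :: "(int \<Rightarrow> complex) \<Rightarrow> bool" where
  "weighted_l2 c \<longleftrightarrow> (\<lambda>k. (cmod (c k))\<^sup>2 * (weight k)\<^sup>2) summable_on UNIV"

lemma weighted_l2_abs_summable:
  assumes "weighted_l2 c"
  shows "(\<lambda>k. norm (c k)) summable_on UNIV"
proof -
  have s: "(\<lambda>k. (cmod (c k))\<^sup>2 * (weight k)\<^sup>2 + 1 / (weight k)\<^sup>2) summable_on UNIV"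
    using assms summable_inverse_weight unfolding weighted_l2_def by (rule summable_on_add)
  have "(\<lambda>k. norm (c k)) summable_on UNIV"
  proof (rule summable_on_comparison_test[OF s])
    fix k
    have w: "weight k > 0" using weight_ge_1[of k] by linarith
    have "2 * ((cmod (c k) * weight k) * (1 / weight k)) \<le> (cmod (c k) * weight k)\<^sup>2 + (1 / weight k)\<^sup>2"
      using sum_squares_bound by (metis mult.assoc)
    then have "2 * cmod (c k) \<le> (cmod (c k))\<^sup>2 * (weight k)\<^sup>2 + 1 / (weight k)\<^sup>2"
      using w by (simp add: power_mult_distrib power_divide)
    then show "norm (c k) \<le> (cmod (c k))\<^sup>2 * (weight k)\<^sup>2 + 1 / (weight k)\<^sup>2"
      using norm_ge_zero[of "c k"] by linarith
  qed auto
  then show ?thesis .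
qed

definition fourier_series :: "(int \<Rightarrow> complex) \<Rightarrow> real \<Rightarrow> complex" where
  "fourier_series c y = (\<Sum>\<^sub>\<infinity>k. c k * cis (2 * pi * of_int k * y))"

lemma
  assumes "(\<lambda>k. norm (c k)) summable_on UNIV"
  shows continuous_fourier_series: "continuous_on UNIV (fourier_series c)"
    and fourier_coeff_fourier_series: "fourier_coeff (fourier_series c) k = c k"
proof -
  have lim: "uniform_limit UNIV (\<lambda>X y. \<Sum>k\<in>X. c k * cis (2 * pi * of_int k * y)) (fourier_series c)
      (finite_subsets_at_top UNIV)"
    unfolding fourier_series_def[abs_def]
    by (rule Weierstrass_m_test_general[OF _ assms]) (simp add: norm_mult)
  show "continuous_on UNIV (fourier_series c)"
    by (rule uniform_limit_theorem[OF _ lim]) (auto intro!: always_eventually continuous_intros)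
  have lim': "uniform_limit {0..1} (\<lambda>X y. (\<Sum>j\<in>X. c j * cis (2 * pi * of_int j * y)) * cis (- (2 * pi * of_int k * y)))
      (\<lambda>y. fourier_series c y * cis (- (2 * pi * of_int k * y))) (finite_subsets_at_top UNIV)"
  proof (rule uniform_limitI)
    fix e :: real assume "e > 0"
    with lim have "\<forall>\<^sub>F X in finite_subsets_at_top UNIV. \<forall>y\<in>UNIV.
        dist (\<Sum>k\<in>X. c k * cis (2 * pi * of_int k * y)) (fourier_series c y) < e"
      by (rule uniform_limitD)
    then show "\<forall>\<^sub>F X in finite_subsets_at_top UNIV. \<forall>y\<in>{0..1}.
        dist ((\<Sum>j\<in>X. c j * cis (2 * pi * of_int j * y)) * cis (- (2 * pi * of_int k * y)))
          (fourier_series c y * cis (- (2 * pi * of_int k * y))) < e"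
      by eventually_elim (simp add: dist_norm norm_mult flip: left_diff_distrib)
  qed
  obtain I J where I: "\<And>X. ((\<lambda>y. (\<Sum>j\<in>X. c j * cis (2 * pi * of_int j * y)) * cis (- (2 * pi * of_int k * y)))
        has_integral I X) {0..1::real}"
    and J: "((\<lambda>y. fourier_series c y * cis (- (2 * pi * of_int k * y))) has_integral J) {0..1}"
    and IJ: "(I \<longlongrightarrow> J) (finite_subsets_at_top UNIV)"
    by (rule uniform_limit_integral[OF lim']) (auto intro!: continuous_intros)
  have fc: "((\<lambda>y. cis (2 * pi * of_int j * y) * cis (- (2 * pi * of_int k * y))) has_integral (if j = k then 1 else 0)) {0..1}" for j
    using has_integral_cis[of "j - k"] by (simp add: cis_mult algebra_simps)
  have IX: "I X = c k" if "finite X" "k \<in> X" for X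
  proof -
    have "((\<lambda>y. \<Sum>j\<in>X. c j * (cis (2 * pi * of_int j * y) * cis (- (2 * pi * of_int k * y))))
        has_integral (\<Sum>j\<in>X. c j * (if j = k then 1 else 0))) {0..1}"
      using that fc by (intro has_integral_sum has_integral_mult_right) auto
    moreover have "(\<Sum>j\<in>X. c j * (if j = k then 1 else 0)) = c k"
    proof -
      have "(\<Sum>j\<in>X. c j * (if j = k then 1 else 0)) = (\<Sum>j\<in>X. if k = j then c j else 0)"
        by (rule sum.cong) auto
      then show ?thesis using that by simp
    qed
    ultimately show ?thesis
      using I[of X] has_integral_unique by (simp add: sum_distrib_right mult.assoc) blast
  qed
  have "\<forall>\<^sub>F X in finite_subsets_at_top UNIV. I X = c k"
    using eventually_finite_subsets_at_top_weakI[of UNIV] unfolding eventually_finite_subsets_at_top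
    by (intro exI[of _ "{k}"]) (auto intro: IX)
  then have "(I \<longlongrightarrow> c k) (finite_subsets_at_top UNIV)"
    by (rule tendsto_eventually)
  with IJ have "J = c k"
    by (intro tendsto_unique[OF finite_subsets_at_top_neq_bot]) auto
  then show "fourier_coeff (fourier_series c) k = c k"
    using J by (simp add: fourier_coeff_def integral_unique)
qed

lemma fourier_series_periodic: "fourier_series c (y + 1) = fourier_series c y"
proof -
  have "cis (2 * pi * of_int k * (y + 1)) = cis (2 * pi * of_int k * y)" for k
  proof -
    have "cis (2 * pi * of_int k * (y + 1)) = cis (2 * pi * of_int k * y) * cis (2 * pi * of_int k)"
      by (simp add: cis_mult algebra_simps)
    also have "cis (2 * pi * of_int k) = 1" by (rule cis_multiple_2pi) simp
    finally show ?thesis by simp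
  qed
  then show ?thesis by (simp add: fourier_series_def)
qed

lemma H1_iff:
  "f \<in> H1 \<longleftrightarrow> continuous_on UNIV f \<and> (\<forall>y. f (y + 1) = f y) \<and> weighted_l2 (fourier_coeff f)"
  by (simp add: H1_def weighted_l2_def)

lemma fourier_series_in_H1:
  assumes "weighted_l2 c"
  shows "fourier_series c \<in> H1"
  using assms continuous_fourier_series[OF weighted_l2_abs_summable[OF assms]]
    fourier_coeff_fourier_series[OF weighted_l2_abs_summable[OF assms]]
  by (simp add: H1_iff fourier_series_periodic weighted_l2_def)

lemma weighted_l2_cmult:
  assumes "weighted_l2 c"
  shows "weighted_l2 (\<lambda>k. z * c k)"
  using summable_on_cmult_right[OF assms[unfolded weighted_l2_def], of "(cmod z)\<^sup>2"]
  unfolding weighted_l2_def by (simp add: norm_mult power_mult_distrib mult.assoc)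

lemma weighted_l2_add:
  assumes "weighted_l2 c" "weighted_l2 d"
  shows "weighted_l2 (\<lambda>k. c k + d k)"
proof -
  have s: "(\<lambda>k. 2 * ((cmod (c k))\<^sup>2 * (weight k)\<^sup>2) + 2 * ((cmod (d k))\<^sup>2 * (weight k)\<^sup>2)) summable_on UNIV"
    using assms unfolding weighted_l2_def by (intro summable_on_add summable_on_cmult_right)
  show ?thesis unfolding weighted_l2_def
  proof (rule summable_on_comparison_test[OF s])
    fix k
    have "(cmod (c k + d k))\<^sup>2 \<le> (cmod (c k) + cmod (d k))\<^sup>2"
      by (intro power_mono norm_triangle_ineq) auto
    also have "\<dots> \<le> 2 * (cmod (c k))\<^sup>2 + 2 * (cmod (d k))\<^sup>2"
      using sum_squares_bound[of "cmod (c k)" "cmod (d k)"] by (simp add: power2_sum)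
    finally have "(cmod (c k + d k))\<^sup>2 * (weight k)\<^sup>2 \<le> (2 * (cmod (c k))\<^sup>2 + 2 * (cmod (d k))\<^sup>2) * (weight k)\<^sup>2"
      by (rule mult_right_mono) simp
    then show "(cmod (c k + d k))\<^sup>2 * (weight k)\<^sup>2
        \<le> 2 * ((cmod (c k))\<^sup>2 * (weight k)\<^sup>2) + 2 * ((cmod (d k))\<^sup>2 * (weight k)\<^sup>2)"
      by (simp add: algebra_simps)
  qed auto
qed

lemma H1_zero: "(\<lambda>y. 0) \<in> H1"
  by (simp add: H1_def)

lemma H1_add:
  assumes "f \<in> H1" "g \<in> H1"
  shows "(\<lambda>y. f y + g y) \<in> H1"
proof -
  have "fourier_coeff (\<lambda>y. f y + g y) = (\<lambda>k. fourier_coeff f k + fourier_coeff g k)"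
    using assms by (intro ext fourier_coeff_add) (auto simp: H1_iff)
  then show ?thesis
    using assms weighted_l2_add[of "fourier_coeff f" "fourier_coeff g"]
    by (auto simp: H1_iff intro!: continuous_intros)
qed

lemma H1_cmult: "f \<in> H1 \<Longrightarrow> (\<lambda>y. c * f y) \<in> H1"
  using weighted_l2_cmult[of "fourier_coeff f" c]
  by (simp add: H1_iff fourier_coeff_cmult[abs_def] continuous_on_mult_left)

lemma H1_diff: "f \<in> H1 \<Longrightarrow> g \<in> H1 \<Longrightarrow> (\<lambda>y. f y - g y) \<in> H1"
  using H1_add[of f "\<lambda>y. (- 1) * g y"] H1_cmult[of g "- 1"] by simp

lemma H1_continuous: "f \<in> H1 \<Longrightarrow> continuous_on UNIV f"
  by (simp add: H1_def)

lemma fourier_coeff_diff: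
  assumes "continuous_on UNIV f" "continuous_on UNIV g"
  shows "fourier_coeff (\<lambda>y. f y - g y) k = fourier_coeff f k - fourier_coeff g k"
  using fourier_coeff_add[of f "\<lambda>y. (- 1) * g y" k] fourier_coeff_cmult[of "- 1" g k] assms
  by (simp add: continuous_on_minus)

lemma H1_norm_nonneg: "H1_norm f \<ge> 0"
  unfolding H1_norm_def by (auto intro!: infsum_nonneg)

lemma H1_norm_partial:
  assumes "f \<in> H1" "finite F"
  shows "L2_set (\<lambda>k. cmod (fourier_coeff f k) * weight k) F \<le> H1_norm f"
  unfolding L2_set_def H1_norm_def
  by (rule real_sqrt_le_mono) (use assms in \<open>auto simp: H1_def power_mult_distrib intro!: finite_sum_le_infsum\<close>)

lemma H1_norm_leI:
  assumes "f \<in> H1" "B \<ge> 0" "\<And>F. finite F \<Longrightarrow> L2_set (\<lambda>k. cmod (fourier_coeff f k) * weight k) F \<le> B"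
  shows "H1_norm f \<le> B"
proof -
  have "(\<Sum>\<^sub>\<infinity>k. (cmod (fourier_coeff f k))\<^sup>2 * (weight k)\<^sup>2) \<le> B\<^sup>2"
  proof (rule infsum_le_finite_sums)
    fix F :: "int set" assume "finite F"
    from assms(3)[OF this] have "(\<Sum>k\<in>F. (cmod (fourier_coeff f k) * weight k)\<^sup>2) \<le> B\<^sup>2"
      unfolding L2_set_def by (rule sqrt_le_D)
    then show "(\<Sum>k\<in>F. (cmod (fourier_coeff f k))\<^sup>2 * (weight k)\<^sup>2) \<le> B\<^sup>2"
      by (simp add: power_mult_distrib)
  qed (use assms(1) in \<open>simp add: H1_def\<close>)
  then show ?thesis
    unfolding H1_norm_def using assms(2) by (rule real_le_lsqrt[rotated])
qed

lemma fourier_coeff_le_H1_norm: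
  assumes "f \<in> H1"
  shows "cmod (fourier_coeff f k) \<le> H1_norm f"
proof -
  have "cmod (fourier_coeff f k) * 1 \<le> cmod (fourier_coeff f k) * weight k"
    using weight_ge_1 by (intro mult_left_mono) auto
  also have "\<dots> \<le> H1_norm f"
    using H1_norm_partial[OF assms, of "{k}"] weight_ge_1[of k] by (simp add: L2_set_def)
  finally show ?thesis by simp
qed

lemma H1_norm_eq_0:
  assumes "f \<in> H1" "H1_norm f = 0"
  shows "f = (\<lambda>y. 0)"
  by (rule fourier_unique)
    (use assms fourier_coeff_le_H1_norm[OF assms(1)] in \<open>auto simp: H1_def\<close>)

lemma H1_norm_triangle:
  assumes "f \<in> H1" "g \<in> H1"
  shows "H1_norm (\<lambda>y. f y + g y) \<le> H1_norm f + H1_norm g"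
proof (rule H1_norm_leI)
  fix F :: "int set" assume F: "finite F"
  have c: "continuous_on UNIV f" "continuous_on UNIV g" using assms by (auto simp: H1_def)
  have "L2_set (\<lambda>k. cmod (fourier_coeff (\<lambda>y. f y + g y) k) * weight k) F
      \<le> L2_set (\<lambda>k. cmod (fourier_coeff f k) * weight k + cmod (fourier_coeff g k) * weight k) F"
  proof (rule L2_set_mono)
    fix k
    have "0 \<le> weight k" using weight_ge_1[of k] by linarith
    then show "cmod (fourier_coeff (\<lambda>y. f y + g y) k) * weight k
        \<le> cmod (fourier_coeff f k) * weight k + cmod (fourier_coeff g k) * weight k"
        "0 \<le> cmod (fourier_coeff (\<lambda>y. f y + g y) k) * weight k"
      unfolding fourier_coeff_add[OF c] distrib_right[symmetric]
      by (auto intro!: mult_right_mono norm_triangle_ineq)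
  qed
  also have "\<dots> \<le> L2_set (\<lambda>k. cmod (fourier_coeff f k) * weight k) F + L2_set (\<lambda>k. cmod (fourier_coeff g k) * weight k) F"
    by (rule L2_set_triangle_ineq)
  also have "\<dots> \<le> H1_norm f + H1_norm g"
    by (intro add_mono H1_norm_partial assms F)
  finally show "L2_set (\<lambda>k. cmod (fourier_coeff (\<lambda>y. f y + g y) k) * weight k) F \<le> H1_norm f + H1_norm g" .
qed (use assms in \<open>auto intro: H1_add H1_norm_nonneg add_nonneg_nonneg\<close>)

lemma H1_norm_cmult: "H1_norm (\<lambda>y. c * f y) = cmod c * H1_norm f"
proof -
  have "(\<Sum>\<^sub>\<infinity>k. (cmod (fourier_coeff (\<lambda>y. c * f y) k))\<^sup>2 * (weight k)\<^sup>2)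
      = (\<Sum>\<^sub>\<infinity>k. (cmod c)\<^sup>2 * ((cmod (fourier_coeff f k))\<^sup>2 * (weight k)\<^sup>2))"
    by (simp add: fourier_coeff_cmult norm_mult power_mult_distrib mult.assoc)
  also have "\<dots> = (cmod c)\<^sup>2 * (\<Sum>\<^sub>\<infinity>k. (cmod (fourier_coeff f k))\<^sup>2 * (weight k)\<^sup>2)"
    by (rule infsum_cmult_right')
  finally show ?thesis by (simp add: H1_norm_def real_sqrt_mult)
qed

subsection \<open>Complex Banach spaces\<close>

class complex_banach = banach +
  fixes scaleC :: "complex \<Rightarrow> 'a \<Rightarrow> 'a"  (infixr "*\<^sub>C" 75)
  assumes scaleC_add_right: "a *\<^sub>C (x + y) = a *\<^sub>C x + a *\<^sub>C y"
    and scaleC_add_left: "(a + b) *\<^sub>C x = a *\<^sub>C x + b *\<^sub>C x"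
    and scaleC_scaleC: "a *\<^sub>C (b *\<^sub>C x) = (a * b) *\<^sub>C x"
    and scaleC_of_real: "of_real r *\<^sub>C x = r *\<^sub>R x"
    and norm_scaleC: "norm (a *\<^sub>C x) = cmod a * norm x"

instantiation complex :: complex_banach
begin

definition scaleC_complex :: "complex \<Rightarrow> complex \<Rightarrow> complex" where
  "scaleC_complex a x = a * x"

instance
  by standard (auto simp: scaleC_complex_def algebra_simps norm_mult scaleR_conv_of_real)

end

instantiation prod :: (complex_banach, complex_banach) complex_banach
begin

definition scaleC_prod :: "complex \<Rightarrow> 'a \<times> 'b \<Rightarrow> 'a \<times> 'b" where
  "scaleC_prod a x = (a *\<^sub>C fst x, a *\<^sub>C snd x)"

instance
proof
  fix a :: complex and x :: "'a \<times> 'b"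
  have "sqrt ((cmod a * norm (fst x))\<^sup>2 + (cmod a * norm (snd x))\<^sup>2)
      = sqrt ((cmod a)\<^sup>2 * ((norm (fst x))\<^sup>2 + (norm (snd x))\<^sup>2))"
    by (simp add: power_mult_distrib distrib_left)
  then show "norm (a *\<^sub>C x) = cmod a * norm x"
    by (simp add: scaleC_prod_def norm_prod_def norm_scaleC real_sqrt_mult)
qed (auto simp: scaleC_prod_def prod_eq_iff scaleC_add_right scaleC_add_left scaleC_scaleC scaleC_of_real)

end

text \<open>The space \<open>\<H>\<^sup>1\<^sup>,\<^sup>+\<^sub>0\<close>, a complex Banach space with the norm of \<open>\<H>\<^sup>1\<close>.\<close>

typedef H1p0 = "{f \<in> H1. \<forall>k\<le>0. fourier_coeff f k = 0}"
  morphisms fn Abs_H1p0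
  by (rule exI[of _ "\<lambda>y. 0"]) (simp add: H1_zero)

setup_lifting type_definition_H1p0

lemma fn_H1: "fn w \<in> H1" and fn_coeff: "k \<le> 0 \<Longrightarrow> fourier_coeff (fn w) k = 0"
  using fn[of w] by auto

lemma fn_continuous: "continuous_on UNIV (fn w)"
  using fn_H1[of w] by (simp add: H1_def)

instantiation H1p0 :: real_normed_vector
begin

lift_definition zero_H1p0 :: H1p0 is "\<lambda>y. 0"
  by (simp add: H1_zero)

lift_definition plus_H1p0 :: "H1p0 \<Rightarrow> H1p0 \<Rightarrow> H1p0" is "\<lambda>f g y. f y + g y"
  by (auto simp: H1_add fourier_coeff_add H1_continuous)

lift_definition minus_H1p0 :: "H1p0 \<Rightarrow> H1p0 \<Rightarrow> H1p0" is "\<lambda>f g y. f y - g y"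
  by (auto simp: H1_diff fourier_coeff_diff H1_continuous)

lift_definition uminus_H1p0 :: "H1p0 \<Rightarrow> H1p0" is "\<lambda>f y. - f y"
  using H1_cmult[of _ "- 1"] fourier_coeff_cmult[of "- 1"] by simp

lift_definition scaleR_H1p0 :: "real \<Rightarrow> H1p0 \<Rightarrow> H1p0" is "\<lambda>r f y. of_real r * f y"
  by (auto simp: H1_cmult fourier_coeff_cmult)

definition norm_H1p0 :: "H1p0 \<Rightarrow> real" where
  "norm_H1p0 w = H1_norm (fn w)"

definition dist_H1p0 :: "H1p0 \<Rightarrow> H1p0 \<Rightarrow> real" where
  "dist_H1p0 v w = norm (v - w)"

definition sgn_H1p0 :: "H1p0 \<Rightarrow> H1p0" where
  "sgn_H1p0 w = inverse (norm w) *\<^sub>R w"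

definition uniformity_H1p0 :: "(H1p0 \<times> H1p0) filter" where
  "uniformity_H1p0 = (INF e\<in>{0 <..}. principal {(v, w). dist v w < e})"

definition open_H1p0 :: "H1p0 set \<Rightarrow> bool" where
  "open_H1p0 U \<longleftrightarrow> (\<forall>w\<in>U. eventually (\<lambda>(w', v). w' = w \<longrightarrow> v \<in> U) uniformity)"

instance
proof
  show "norm x = 0 \<longleftrightarrow> x = 0" for x :: H1p0
  proof
    assume "norm x = 0"
    then have "fn x = (\<lambda>y. 0)" by (intro H1_norm_eq_0 fn_H1) (simp add: norm_H1p0_def)
    then show "x = 0" by (simp add: fn_inject[symmetric] zero_H1p0.rep_eq)
  next
    assume x: "x = 0"
    then show "norm x = 0" by (simp add: norm_H1p0_def H1_norm_def zero_H1p0.rep_eq)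
  qed
  show "norm (x + y) \<le> norm x + norm y" for x y :: H1p0
    unfolding norm_H1p0_def plus_H1p0.rep_eq by (intro H1_norm_triangle fn_H1)
  show "norm (r *\<^sub>R x) = \<bar>r\<bar> * norm x" for r and x :: H1p0
    by (simp add: norm_H1p0_def scaleR_H1p0.rep_eq H1_norm_cmult)
qed (simp_all add: dist_H1p0_def sgn_H1p0_def uniformity_H1p0_def open_H1p0_def,
     (transfer; simp add: algebra_simps fun_eq_iff)+)

end

instance H1p0 :: banach
proof
  fix X :: "nat \<Rightarrow> H1p0"
  assume "Cauchy X"
  then have Cauchy: "\<exists>M. \<forall>m\<ge>M. \<forall>n\<ge>M. norm (X m - X n) < e" if "e > 0" for e
    using that unfolding Cauchy_def dist_norm by blast
  define a where "a n k = fourier_coeff (fn (X n)) k" for n k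
  have adiff: "fourier_coeff (fn (X m - X n)) k = a m k - a n k" for m n k
    by (simp add: a_def minus_H1p0.rep_eq fourier_coeff_diff fn_continuous)
  have "convergent (\<lambda>n. a n k)" for k
  proof -
    have "cmod (a m k - a n k) \<le> norm (X m - X n)" for m n
      using fourier_coeff_le_H1_norm[OF fn_H1, of "X m - X n" k] by (simp add: adiff norm_H1p0_def)
    then have "Cauchy (\<lambda>n. a n k)"
      using Cauchy unfolding Cauchy_def dist_norm by (meson le_less_trans)
    then show ?thesis by (simp add: Cauchy_convergent_iff)
  qed
  then have "\<exists>l. (\<lambda>n. a n k) \<longlonglongrightarrow> l" for k by (simp add: convergent_def)
  then obtain c where c: "\<And>k. (\<lambda>n. a n k) \<longlonglongrightarrow> c k" by metis
  have partial: "L2_set (\<lambda>k. cmod (a m k - a n k) * weight k) F \<le> norm (X m - X n)" if "finite F" for m n F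
    using H1_norm_partial[OF fn_H1 that, of "X m - X n"] by (simp add: adiff norm_H1p0_def)
  have tail: "\<exists>M. \<forall>n\<ge>M. \<forall>F. finite F \<longrightarrow> L2_set (\<lambda>k. cmod (c k - a n k) * weight k) F \<le> e" if e: "e > 0" for e
  proof -
    obtain M where M: "\<And>m n. m \<ge> M \<Longrightarrow> n \<ge> M \<Longrightarrow> norm (X m - X n) < e"
      using Cauchy[OF e] by blast
    have "L2_set (\<lambda>k. cmod (c k - a n k) * weight k) F \<le> e" if "n \<ge> M" "finite F" for n F
    proof (rule tendsto_upperbound)
      show "(\<lambda>m. L2_set (\<lambda>k. cmod (a m k - a n k) * weight k) F)
          \<longlonglongrightarrow> L2_set (\<lambda>k. cmod (c k - a n k) * weight k) F"
        unfolding L2_set_def by (intro tendsto_intros c)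
      show "\<forall>\<^sub>F m in sequentially. L2_set (\<lambda>k. cmod (a m k - a n k) * weight k) F \<le> e"
        using eventually_ge_at_top[of M]
        by eventually_elim (use M that partial[OF \<open>finite F\<close>] in \<open>meson le_less_trans less_imp_le\<close>)
    qed simp
    then show ?thesis by blast
  qed
  have diff_l2: "\<exists>n. weighted_l2 (\<lambda>k. c k - a n k)"
  proof -
    obtain n where n: "\<And>F. finite F \<Longrightarrow> L2_set (\<lambda>k. cmod (c k - a n k) * weight k) F \<le> 1"
      using tail[of 1] by auto
    have "weighted_l2 (\<lambda>k. c k - a n k)"
      unfolding weighted_l2_def
    proof (rule nonneg_bdd_above_summable_on)
      show "bdd_above (sum (\<lambda>k. (cmod (c k - a n k))\<^sup>2 * (weight k)\<^sup>2) ` {F. F \<subseteq> UNIV \<and> finite F})"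
      proof (rule bdd_aboveI2)
        fix F :: "int set" assume "F \<in> {F. F \<subseteq> UNIV \<and> finite F}"
        then have "sqrt (\<Sum>k\<in>F. (cmod (c k - a n k) * weight k)\<^sup>2) \<le> 1"
          using n[of F] by (simp add: L2_set_def)
        then show "(\<Sum>k\<in>F. (cmod (c k - a n k))\<^sup>2 * (weight k)\<^sup>2) \<le> 1"
          by (simp add: power_mult_distrib)
      qed
    qed auto
    then show ?thesis by blast
  qed
  then obtain n where "weighted_l2 (\<lambda>k. c k - a n k)" by blast
  moreover have "weighted_l2 (a n)"
    using fn_H1[of "X n"] by (simp add: H1_iff a_def[abs_def])
  ultimately have cl2: "weighted_l2 c"
    using weighted_l2_add[of "\<lambda>k. c k - a n k" "a n"] by simp
  have cneg: "c k = 0" if "k \<le> 0" for k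
    using c[of k] fn_coeff[OF that] by (simp add: a_def LIMSEQ_const_iff)
  note fc = fourier_coeff_fourier_series[OF weighted_l2_abs_summable[OF cl2]]
  have mem: "fourier_series c \<in> {f \<in> H1. \<forall>k\<le>0. fourier_coeff f k = 0}"
    using fourier_series_in_H1[OF cl2] cneg by (simp add: fc)
  define g where "g = Abs_H1p0 (fourier_series c)"
  have fng: "fourier_coeff (fn g) k = c k" for k
    using Abs_H1p0_inverse[OF mem] by (simp add: g_def fc)
  have gdiff: "fourier_coeff (fn (g - X n)) k = c k - a n k" for n k
    by (simp add: minus_H1p0.rep_eq fourier_coeff_diff fn_continuous fng a_def)
  have dist_swap: "dist (X n) g = norm (g - X n)" for n
    by (simp add: dist_norm norm_minus_commute)
  have "X \<longlonglongrightarrow> g"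
  proof (rule metric_LIMSEQ_I)
    fix e :: real assume e: "e > 0"
    obtain M where M: "\<And>n F. n \<ge> M \<Longrightarrow> finite F \<Longrightarrow> L2_set (\<lambda>k. cmod (c k - a n k) * weight k) F \<le> e / 2"
      using tail[of "e / 2"] e by auto
    have "norm (g - X n) \<le> e / 2" if "n \<ge> M" for n
      unfolding norm_H1p0_def
      by (rule H1_norm_leI) (use that e M in \<open>auto simp: gdiff fn_H1\<close>)
    then show "\<exists>M. \<forall>n\<ge>M. dist (X n) g < e"
      using e by (intro exI[of _ M]) (fastforce simp: dist_swap)
  qed
  then show "convergent X" by (auto simp: convergent_def)
qed

instantiation H1p0 :: complex_banach
begin

lift_definition scaleC_H1p0 :: "complex \<Rightarrow> H1p0 \<Rightarrow> H1p0" is "\<lambda>c f y. c * f y"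
  by (auto simp: H1_cmult fourier_coeff_cmult)

instance
proof
  show "norm (c *\<^sub>C w) = cmod c * norm w" for c and w :: H1p0
    by (simp add: norm_H1p0_def scaleC_H1p0.rep_eq H1_norm_cmult)
qed (transfer; simp add: algebra_simps)+

end

subsection \<open>Analytic maps\<close>

text \<open>
  Analytic means continuously Frechet differentiable on an open set with complex-linear
  differential, the differential being continuous for the operator norm.
\<close>

definition banach_analytic :: "('a::complex_banach \<Rightarrow> 'b::complex_banach) \<Rightarrow> 'a set \<Rightarrow> bool" where
  "banach_analytic F U \<longleftrightarrow> open U \<and>
     (\<exists>D :: 'a \<Rightarrow> 'a \<Rightarrow>\<^sub>L 'b. continuous_on U D \<and>
        (\<forall>x\<in>U. (F has_derivative blinfun_apply (D x)) (at x) \<and>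
               (\<forall>c h. blinfun_apply (D x) (c *\<^sub>C h) = c *\<^sub>C blinfun_apply (D x) h)))"

subsection \<open>Operators\<close>

definition proj_plus :: "(real \<Rightarrow> complex) \<Rightarrow> real \<Rightarrow> complex" where
  "proj_plus f y = (\<Sum>\<^sub>\<infinity>k\<in>{0..}. fourier_coeff f k * cis (2 * pi * of_int k * y))"

definition proj_plus0 :: "(real \<Rightarrow> complex) \<Rightarrow> real \<Rightarrow> complex" where
  "proj_plus0 f y = (\<Sum>\<^sub>\<infinity>k\<in>{1..}. fourier_coeff f k * cis (2 * pi * of_int k * y))"

definition pairing :: "(real \<Rightarrow> complex) \<Rightarrow> (real \<Rightarrow> complex) \<Rightarrow> complex" where
  "pairing f g = (\<Sum>\<^sub>\<infinity>k. fourier_coeff f k * fourier_coeff g k)"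

definition shift :: "(real \<Rightarrow> complex) \<Rightarrow> real \<Rightarrow> complex" where
  "shift f y = f y * cis (- (2 * pi * y))"

definition op_A :: "nat \<Rightarrow> (real \<Rightarrow> complex) \<Rightarrow> (real \<Rightarrow> complex) \<Rightarrow> real \<Rightarrow> complex" where
  "op_A k w g y = g y * proj_plus ((shift ^^ (k + 1)) w) y - w y * proj_plus ((shift ^^ (k + 1)) g) y"

definition hankel :: "(real \<Rightarrow> complex) \<Rightarrow> (real \<Rightarrow> complex) \<Rightarrow> real \<Rightarrow> complex" where
  "hankel w p = proj_plus0 (\<lambda>y. w y * p (- y))"

subsection \<open>Phase space and Poisson bracket\<close>

definition nonvanishing :: "H1p0 set" where
  "nonvanishing = {w. \<forall>y. fn w y \<noteq> 0}"

definition phase_space :: "(H1p0 \<times> H1p0) set" where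
  "phase_space = nonvanishing \<times> UNIV"

text \<open>Gradients are distributions, given by their sequences of Fourier coefficients.\<close>

definition has_gradient_w :: "(H1p0 \<times> H1p0 \<Rightarrow> complex) \<Rightarrow> H1p0 \<times> H1p0 \<Rightarrow> (int \<Rightarrow> complex) \<Rightarrow> bool" where
  "has_gradient_w F x a \<longleftrightarrow> F differentiable (at x) \<and> (\<forall>k\<le>0. a k = 0) \<and>
     (\<forall>h. ((\<lambda>k. a k * fourier_coeff (fn h) k) has_sum frechet_derivative F (at x) (h, 0)) UNIV)"

definition has_gradient_p :: "(H1p0 \<times> H1p0 \<Rightarrow> complex) \<Rightarrow> H1p0 \<times> H1p0 \<Rightarrow> (int \<Rightarrow> complex) \<Rightarrow> bool" where
  "has_gradient_p F x a \<longleftrightarrow> F differentiable (at x) \<and> (\<forall>k\<le>0. a k = 0) \<and>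
     (\<forall>h. ((\<lambda>k. a k * fourier_coeff (fn h) k) has_sum frechet_derivative F (at x) (0, h)) UNIV)"

text \<open>
  The bracket is a partial operation: \<open>has_poisson_bracket F G x b\<close> says that all gradients exist
  at \<open>x\<close>, that both pairings converge, and that the bracket has value \<open>b\<close> at \<open>x\<close>. The gradients
  are unique, hence so is \<open>b\<close>.
\<close>

definition has_poisson_bracket ::
  "(H1p0 \<times> H1p0 \<Rightarrow> complex) \<Rightarrow> (H1p0 \<times> H1p0 \<Rightarrow> complex) \<Rightarrow> H1p0 \<times> H1p0 \<Rightarrow> complex \<Rightarrow> bool" where
  "has_poisson_bracket F G x b \<longleftrightarrow>
     (\<exists>Fw Fp Gw Gp s t.
        has_gradient_w F x Fw \<and> has_gradient_p F x Fp \<and>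
        has_gradient_w G x Gw \<and> has_gradient_p G x Gp \<and>
        ((\<lambda>k. Fp k * Gw k) has_sum s) UNIV \<and> ((\<lambda>k. Fw k * Gp k) has_sum t) UNIV \<and>
        b = s - t)"

subsection \<open>The Hamiltonian and its integrals\<close>

definition hamiltonian :: "(real \<Rightarrow> complex) \<Rightarrow> H1p0 \<times> H1p0 \<Rightarrow> complex" where
  "hamiltonian f = (\<lambda>(w, p).
     pairing (fn w) (\<lambda>y. (fn p y)\<^sup>2) + integral {0..1} (\<lambda>y. f y / fn w y))"

definition integral_I :: "nat \<Rightarrow> H1p0 \<times> H1p0 \<Rightarrow> complex" where
  "integral_I k = (\<lambda>(w, p). pairing (op_A k (fn w) (hankel (fn w) (fn p))) (fn p))"

definition potential_U :: "(real \<Rightarrow> complex) \<Rightarrow> nat \<Rightarrow> H1p0 \<Rightarrow> complex" where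
  "potential_U f k w =
     - fourier_coeff (\<lambda>y. fn w y * proj_plus0 (\<lambda>x. f x / fn w x) y) (int k + 1)"

definition integral_J :: "(real \<Rightarrow> complex) \<Rightarrow> nat \<Rightarrow> H1p0 \<times> H1p0 \<Rightarrow> complex" where
  "integral_J f k = (\<lambda>(w, p). integral_I k (w, p) + potential_U f k w)"

end

theory Submission
  imports Defs
begin

text \<open>
  Put \<open>z = e\<^sup>2\<^sup>\<pi>\<^sup>i\<^sup>y\<close>, \<open>P(y) = p(-y)\<close>, \<open>u = \<Pi>\<^sup>+\<^sub>0(wP)\<close>, \<open>v = wP - u\<close> and \<open>\<kappa> = wP\<^sup>2 + f/w\<close>. Since \<open>vP\<close> has only negative
  frequencies, \<open>J\<^sub>k\<close> is the Fourier coefficient of index \<open>k + 1\<close> of \<open>u\<^sup>2 - w \<Pi>\<^sup>+\<^sub>0 \<kappa>\<close>, while \<open>H\<close> is the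
  mean of \<open>\<kappa>\<close>. So \<open>J\<^sub>k\<close> is a polynomial in finitely many Fourier coefficients of \<open>w\<close>, \<open>wP\<close> and \<open>\<kappa>\<close>,
  which are analytic by differentiation under the integral sign. With \<open>\<phi> = z\<^sup>-\<^sup>m\<close>, \<open>m = k + 1\<close>, and with
  \<open>\<alpha>\<close>, \<open>\<psi>\<close> the negative-frequency parts of \<open>\<phi>u\<close>, \<open>\<phi>w\<close>, the gradients of \<open>J\<^sub>k\<close> are \<open>2(w\<alpha> - u\<psi>)\<close> in \<open>p\<close>
  and \<open>2\<alpha>P - \<psi>(P\<^sup>2 - f/w\<^sup>2) - \<phi> \<Pi>\<^sup>+\<^sub>0 \<kappa>\<close> in \<open>w\<close>. In every bracket the integrand then splits into a function
  with only negative and one with only positive frequencies, both of mean zero.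
\<close>

section \<open>Fourier series\<close>

definition mode :: "int \<Rightarrow> real \<Rightarrow> complex" where
  "mode k y = cis (2 * pi * of_int k * y)"

lemma mode_mult: "mode k y * mode l y = mode (k + l) y"
  by (simp add: mode_def cis_mult algebra_simps)

lemma mode_0 [simp]: "mode 0 y = 1"
  by (simp add: mode_def)

lemma norm_mode [simp]: "cmod (mode k y) = 1"
  by (simp add: mode_def)

lemma mode_add: "mode k (x + y) = mode k x * mode k y"
  by (simp add: mode_def cis_mult algebra_simps)

lemma mode_minus: "mode k (- y) = mode (- k) y"
  by (simp add: mode_def)

lemma mode_of_int [simp]: "mode k (of_int n) = 1"
  using cis_multiple_2pi[of "of_int (k * n)"] by (simp add: mode_def mult_ac)

lemma continuous_on_mode [continuous_intros]:
  "continuous_on A g \<Longrightarrow> continuous_on A (\<lambda>y. mode k (g y))"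
  unfolding mode_def by (intro continuous_intros)

lemma fourier_coeff_mode: "fourier_coeff (mode m) k = (if m = k then 1 else 0)"
  using fourier_coeff_character[of m k] by (simp add: mode_def[abs_def])

lemma fourier_coeff_conv_mode: "fourier_coeff f k = integral {0..1} (\<lambda>y. f y * mode (- k) y)"
  by (simp add: fourier_coeff_def mode_def)

lemma fourier_coeff_0: "fourier_coeff f 0 = integral {0..1} f"
  by (simp add: fourier_coeff_conv_mode)

lemma fourier_coeff_mode_mult:
  "fourier_coeff (\<lambda>y. mode n y * f y) k = fourier_coeff f (k - n)"
proof -
  have "(\<lambda>y. mode n y * f y * mode (- k) y) = (\<lambda>y. f y * mode (- (k - n)) y)"
    using mode_mult[of n _ "- k"] by (simp add: fun_eq_iff mult_ac)
  then show ?thesis by (simp only: fourier_coeff_conv_mode)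
qed

lemma fourier_coeff_mult_mode:
  "fourier_coeff (\<lambda>y. f y * mode n y) k = fourier_coeff f (k - n)"
  using fourier_coeff_mode_mult[of n f k] by (simp add: mult.commute)

section \<open>Fourier inversion, Parseval and convolution\<close>

lemma H1_periodic: "f \<in> H1 \<Longrightarrow> f (y + 1) = f y"
  by (simp add: H1_def)

lemma H1_norm_coeff_summable:
  "f \<in> H1 \<Longrightarrow> (\<lambda>k. cmod (fourier_coeff f k)) summable_on UNIV"
  by (rule weighted_l2_abs_summable) (simp add: H1_iff)

text \<open>Both sides are continuous and periodic with equal coefficients, so
  \<open>fourier_unique\<close> makes their difference vanish.\<close>

lemma fourier_series_fourier_coeff:
  assumes "f \<in> H1"
  shows "fourier_series (fourier_coeff f) = f"
proof -
  let ?s = "fourier_series (fourier_coeff f)"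
  have l2: "weighted_l2 (fourier_coeff f)" using assms by (simp add: H1_iff)
  have s: "?s \<in> H1" using fourier_series_in_H1[OF l2] .
  have "(\<lambda>y. ?s y - f y) = (\<lambda>y. 0)"
  proof (rule fourier_unique)
    show "fourier_coeff (\<lambda>y. ?s y - f y) k = 0" for k
      using assms s
      by (simp add: fourier_coeff_diff H1_continuous
          fourier_coeff_fourier_series[OF weighted_l2_abs_summable[OF l2]])
  qed (use H1_diff[OF s assms] in \<open>auto simp: H1_def\<close>)
  then show ?thesis by (simp add: fun_eq_iff)
qed

lemma has_sum_fourier:
  assumes "f \<in> H1"
  shows "((\<lambda>k. fourier_coeff f k * mode k y) has_sum f y) UNIV"
proof -
  have "(\<lambda>k. fourier_coeff f k * mode k y) summable_on UNIV"
    by (rule abs_summable_summable) (use H1_norm_coeff_summable[OF assms] in \<open>simp add: norm_mult\<close>)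
  then have "((\<lambda>k. fourier_coeff f k * mode k y) has_sum fourier_series (fourier_coeff f) y) UNIV"
    unfolding fourier_series_def mode_def by (rule has_sum_infsum)
  then show ?thesis by (simp add: fourier_series_fourier_coeff[OF assms])
qed

text \<open>The series of \<open>f\<close> converges absolutely and uniformly and \<open>g\<close>
  is bounded on a period, so the product may be integrated term by term. The form is bilinear, hence
  the index \<open>- k\<close> in place of a conjugate.\<close>

lemma has_sum_parseval:
  assumes f: "f \<in> H1" and g: "continuous_on UNIV g"
  shows "((\<lambda>k. fourier_coeff f k * fourier_coeff g (- k)) has_sum
      fourier_coeff (\<lambda>y. f y * g y) 0) UNIV"
proof -
  have cg: "continuous_on {0..1} g" using g continuous_on_subset by blast
  have "compact (g ` {0..1})" using cg by (intro compact_continuous_image) auto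
  then obtain M where M: "M > 0" "\<And>y. y \<in> {0..1} \<Longrightarrow> cmod (g y) \<le> M"
    using compact_imp_bounded bounded_pos by (metis imageI)
  have "uniform_limit {0..1} (\<lambda>X y. \<Sum>k\<in>X. fourier_coeff f k * mode k y * g y)
      (\<lambda>y. \<Sum>\<^sub>\<infinity>k. fourier_coeff f k * mode k y * g y) (finite_subsets_at_top UNIV)"
  proof (rule Weierstrass_m_test_general)
    show "(\<lambda>k. cmod (fourier_coeff f k) * M) summable_on UNIV"
      by (rule summable_on_cmult_left[OF H1_norm_coeff_summable[OF f]])
    show "norm (fourier_coeff f k * mode k y * g y) \<le> cmod (fourier_coeff f k) * M"
      if "y \<in> {0..1}" for k y
      using M(2)[OF that] by (simp add: norm_mult mult_left_mono)
  qed
  moreover have "(\<Sum>\<^sub>\<infinity>k. fourier_coeff f k * mode k y * g y) = f y * g y" for y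
    by (intro infsumI has_sum_cmult_left has_sum_fourier f)
  ultimately have lim: "uniform_limit {0..1} (\<lambda>X y. \<Sum>k\<in>X. fourier_coeff f k * mode k y * g y)
      (\<lambda>y. f y * g y) (finite_subsets_at_top UNIV)"
    by simp
  obtain I J where I: "\<And>X. ((\<lambda>y. \<Sum>k\<in>X. fourier_coeff f k * mode k y * g y) has_integral I X) {0..1::real}"
    and J: "((\<lambda>y. f y * g y) has_integral J) {0..1}"
    and IJ: "(I \<longlongrightarrow> J) (finite_subsets_at_top UNIV)"
    by (rule uniform_limit_integral[OF lim]) (auto intro!: continuous_intros cg)
  have "((\<lambda>y. mode k y * g y) has_integral fourier_coeff g (- k)) {0..1}" for k
  proof -
    have "(\<lambda>y. mode k y * g y) integrable_on {0..1}"
      by (intro integrable_continuous_real continuous_intros cg)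
    then show ?thesis
      by (simp add: has_integral_integral fourier_coeff_conv_mode mult.commute)
  qed
  then have "((\<lambda>y. \<Sum>k\<in>X. fourier_coeff f k * (mode k y * g y)) has_integral
      (\<Sum>k\<in>X. fourier_coeff f k * fourier_coeff g (- k))) {0..1}" if "finite X" for X
    using that by (intro has_integral_sum has_integral_mult_right)
  then have "I X = (\<Sum>k\<in>X. fourier_coeff f k * fourier_coeff g (- k))" if "finite X" for X
    using I[of X] that has_integral_unique by (simp add: mult.assoc) blast
  then have "((\<lambda>X. \<Sum>k\<in>X. fourier_coeff f k * fourier_coeff g (- k)) \<longlongrightarrow> J) (finite_subsets_at_top UNIV)"
    by (intro Lim_transform_eventually[OF IJ] eventually_finite_subsets_at_top_weakI)
  then show ?thesis
    unfolding has_sum_def fourier_coeff_0 integral_unique[OF J] by simp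
qed

text \<open>Parseval applied to \<open>g\<close> times \<open>mode (- k)\<close>, whose coefficients
  are those of \<open>g\<close> shifted by \<open>k\<close>.\<close>

lemma has_sum_convolution:
  assumes "f \<in> H1" "continuous_on UNIV g"
  shows "((\<lambda>j. fourier_coeff f j * fourier_coeff g (k - j)) has_sum
      fourier_coeff (\<lambda>y. f y * g y) k) UNIV"
proof -
  have "continuous_on UNIV (\<lambda>y. g y * mode (- k) y)" by (intro continuous_intros assms(2))
  from has_sum_parseval[OF assms(1) this] show ?thesis
    by (simp add: fourier_coeff_mult_mode fourier_coeff_mult_mode[of "\<lambda>y. f y * g y" "- k" 0, symmetric]
        flip: mult.assoc)
qed

lemma in_H1_coeffI:
  assumes "\<And>k. fourier_coeff f k = c k" "weighted_l2 c" "continuous_on UNIV f" "\<And>y. f (y + 1) = f y"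
  shows "f \<in> H1"
  using assms(2-4) by (simp add: H1_iff assms(1)[abs_def])

lemma weighted_l2_compare:
  assumes "weighted_l2 c" "\<And>k. cmod (d k) \<le> cmod (c k)"
  shows "weighted_l2 d"
  unfolding weighted_l2_def
proof (rule summable_on_comparison_test)
  show "(\<lambda>k. (cmod (c k))\<^sup>2 * (weight k)\<^sup>2) summable_on UNIV"
    using assms(1) by (simp add: weighted_l2_def)
qed (auto intro!: mult_right_mono power_mono assms(2))

lemma weighted_l2_finite:
  assumes "finite {k. c k \<noteq> 0}"
  shows "weighted_l2 c"
proof -
  have "(\<lambda>k. (cmod (c k))\<^sup>2 * (weight k)\<^sup>2) summable_on {k. c k \<noteq> 0}"
    using assms by simp
  then show ?thesis
    unfolding weighted_l2_def by (rule summable_on_cong_neutral[THEN iffD1, rotated -1]) auto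
qed

lemma H1_mode: "mode n \<in> H1"
proof (rule in_H1_coeffI[OF fourier_coeff_mode])
  show "weighted_l2 (\<lambda>k. if n = k then 1 else 0)"
    by (rule weighted_l2_finite) (auto intro: finite_subset[of _ "{n}"])
  show "mode n (y + 1) = mode n y" for y
    using mode_of_int[of n 1] by (simp add: mode_add)
  show "continuous_on UNIV (mode n)"
    using continuous_on_mode[OF continuous_on_id, of UNIV n] by simp
qed

lemma weight_minus [simp]: "weight (- k) = weight k"
  by (simp add: weight_def flip: of_int_abs)

text \<open>Evaluating the series of \<open>f\<close> at \<open>- y\<close> and reindexing by
  negation exhibits the reflected function as a Fourier series with known coefficients.\<close>

lemma fourier_coeff_reflect:
  assumes "f \<in> H1"
  shows "fourier_coeff (\<lambda>y. f (- y)) k = fourier_coeff f (- k)"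
proof -
  have s: "(\<lambda>k. cmod (fourier_coeff f (- k))) summable_on UNIV"
    using H1_norm_coeff_summable[OF assms]
    by (subst summable_on_reindex_bij_betw[of uminus UNIV UNIV "\<lambda>k. cmod (fourier_coeff f k)"])
      (auto simp: bij_uminus)
  have "((\<lambda>k. fourier_coeff f (- k) * mode k y) has_sum f (- y)) UNIV" for y
    using has_sum_fourier[OF assms, of "- y"]
    by (subst has_sum_reindex_bij_betw[of uminus UNIV UNIV "\<lambda>k. fourier_coeff f k * mode (- k) y", simplified])
      (auto simp: bij_uminus mode_minus)
  then have "(\<lambda>y. f (- y)) = fourier_series (\<lambda>k. fourier_coeff f (- k))"
    by (auto simp: fun_eq_iff fourier_series_def mode_def intro!: infsumI[symmetric])
  then show ?thesis
    using fourier_coeff_fourier_series[OF s] by simp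
qed

lemma H1_reflect:
  assumes "f \<in> H1"
  shows "(\<lambda>y. f (- y)) \<in> H1"
proof (rule in_H1_coeffI[OF fourier_coeff_reflect[OF assms]])
  have "(\<lambda>k. (cmod (fourier_coeff f k))\<^sup>2 * (weight k)\<^sup>2) summable_on UNIV"
    using assms by (simp add: H1_def)
  then show "weighted_l2 (\<lambda>k. fourier_coeff f (- k))"
    unfolding weighted_l2_def
    using summable_on_reindex_bij_betw[of uminus UNIV UNIV "\<lambda>k. (cmod (fourier_coeff f k))\<^sup>2 * (weight k)\<^sup>2"]
    by (simp add: bij_uminus weight_minus)
  show "continuous_on UNIV (\<lambda>y. f (- y))"
    by (rule continuous_on_compose2[OF H1_continuous[OF assms]]) (auto intro!: continuous_intros)
  show "f (- (y + 1)) = f (- y)" for y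
    using H1_periodic[OF assms, of "- y - 1"] by simp
qed

section \<open>The algebra of functions with square-integrable derivative\<close>

text \<open>The window from \<open>h\<close> to \<open>1 + h\<close> is cut at 1 and its right piece
  is moved back by one period.\<close>

lemma integral_periodic_shift:
  fixes g :: "real \<Rightarrow> complex"
  assumes g: "continuous_on UNIV g" and per: "\<And>y. g (y + 1) = g y" and h: "0 \<le> h" "h \<le> 1"
  shows "integral {0..1} (\<lambda>y. g (y + h)) = integral {0..1} g"
proof -
  have i: "g integrable_on {a..b}" for a b
    using g by (intro integrable_continuous_real) (rule continuous_on_subset, auto)
  have "integral {0..1} (\<lambda>y. g (y + h)) = integral {h..1 + h} g"
    using integral_shift_real_ivl[of h h "1 + h" g] by simp
  also have "\<dots> = integral {h..1} g + integral {1..1 + h} g"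
    using h by (intro Henstock_Kurzweil_Integration.integral_combine[symmetric] i) auto
  also have "integral {1..1 + h} g = integral {0..h} g"
    using integral_shift_real_ivl[of 1 1 "1 + h" g] by (simp add: per)
  also have "integral {h..1} g + integral {0..h} g = integral {0..1} g"
    using Henstock_Kurzweil_Integration.integral_combine[of 0 h 1 g] h i by (simp add: add.commute)
  finally show ?thesis .
qed

lemma fourier_coeff_translate:
  assumes g: "continuous_on UNIV f" and per: "\<And>y. f (y + 1) = f y" and h: "0 \<le> h" "h \<le> 1"
  shows "fourier_coeff (\<lambda>y. f (y + h)) k = mode k h * fourier_coeff f k"
proof -
  have "(\<lambda>y. f (y + h) * mode (- k) y) = (\<lambda>y. mode k h * (f (y + h) * mode (- k) (y + h)))"
    using mode_mult[of k h "- k"] by (simp add: fun_eq_iff mode_add mult_ac)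
  then have "fourier_coeff (\<lambda>y. f (y + h)) k
      = integral {0..1} (\<lambda>y. mode k h * (f (y + h) * mode (- k) (y + h)))"
    by (simp only: fourier_coeff_conv_mode)
  also have "\<dots> = mode k h * integral {0..1} (\<lambda>y. f (y + h) * mode (- k) (y + h))"
    by simp
  also have "integral {0..1} (\<lambda>y. f (y + h) * mode (- k) (y + h)) = fourier_coeff f k"
    unfolding fourier_coeff_conv_mode
    by (rule integral_periodic_shift)
      (use h per H1_periodic[OF H1_mode, of "- k"] in \<open>auto intro!: continuous_intros g\<close>)
  finally show ?thesis .
qed

section \<open>The Plancherel identity and the Bessel inequality\<close>

lemma integrable_norm_power2:
  assumes "continuous_on UNIV f"
  shows "(\<lambda>y. (cmod (f y))\<^sup>2) integrable_on {a..b::real}"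
  by (intro integrable_continuous_real continuous_intros continuous_on_subset[OF assms]) auto

lemma fourier_coeff_norm_power2:
  assumes "continuous_on UNIV f"
  shows "fourier_coeff (\<lambda>y. f y * cnj (f y)) 0 = of_real (integral {0..1} (\<lambda>y. (cmod (f y))\<^sup>2))"
proof -
  have "(\<lambda>y. f y * cnj (f y)) = complex_of_real \<circ> (\<lambda>y. (cmod (f y))\<^sup>2)"
    unfolding o_def complex_norm_square ..
  then show ?thesis
    using integral_linear[OF integrable_norm_power2[OF assms, of 0 1] bounded_linear_of_real]
    by (simp add: fourier_coeff_0)
qed

lemma fourier_coeff_cnj:
  assumes "continuous_on UNIV f"
  shows "fourier_coeff (\<lambda>y. cnj (f y)) k = cnj (fourier_coeff f (- k))"
proof -
  have i: "(\<lambda>y. f y * mode k y) integrable_on {0..1}"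
    by (intro integrable_continuous_real continuous_intros continuous_on_subset[OF assms]) auto
  have "(\<lambda>y. cnj (f y) * mode (- k) y) = cnj \<circ> (\<lambda>y. f y * mode k y)"
    by (simp add: fun_eq_iff mode_def cis_cnj)
  then show ?thesis
    using integral_linear[OF i bounded_linear_cnj] by (simp add: fourier_coeff_conv_mode)
qed

lemma has_sum_plancherel:
  assumes "f \<in> H1"
  shows "((\<lambda>k. (cmod (fourier_coeff f k))\<^sup>2) has_sum integral {0..1} (\<lambda>y. (cmod (f y))\<^sup>2)) UNIV"
proof -
  have c: "continuous_on UNIV f" using assms by (rule H1_continuous)
  have "((\<lambda>k. complex_of_real ((cmod (fourier_coeff f k))\<^sup>2)) has_sum
      complex_of_real (integral {0..1} (\<lambda>y. (cmod (f y))\<^sup>2))) UNIV"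
    using has_sum_parseval[OF assms continuous_on_cnj[OF c]]
    by (simp only: fourier_coeff_cnj[OF c] fourier_coeff_norm_power2[OF c] minus_minus
        complex_norm_square)
  then show ?thesis by (simp only: has_sum_of_real_iff)
qed

text \<open>Here \<open>f\<close> is only continuous, so Plancherel for \<open>H1\<close> does not
  apply. The integral of \<open>|f - s|^2\<close> is nonnegative for the trigonometric polynomial
  \<open>s\<close> built from the coefficients in \<open>F\<close>, and each of the three products
  involving \<open>s\<close> has the same finite sum as its mean.\<close>

lemma bessel:
  assumes f: "continuous_on UNIV f" and F: "finite F"
  shows "(\<Sum>k\<in>F. (cmod (fourier_coeff f k))\<^sup>2) \<le> integral {0..1} (\<lambda>y. (cmod (f y))\<^sup>2)"
proof -
  define s where "s y = (\<Sum>k\<in>F. fourier_coeff f k * mode k y)" for y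
  have cs: "continuous_on UNIV s" unfolding s_def by (intro continuous_intros)
  define c where "c k = (if k \<in> F then fourier_coeff f k else 0)" for k
  have sc: "fourier_coeff s k = c k" for k
  proof -
    have "((\<lambda>y. \<Sum>j\<in>F. fourier_coeff f j * (mode j y * mode (- k) y)) has_integral
        (\<Sum>j\<in>F. fourier_coeff f j * (if j = k then 1 else 0))) {0..1}"
    proof (intro has_integral_sum has_integral_mult_right F)
      fix j
      have "(\<lambda>y. mode j y * mode (- k) y) integrable_on {0..1}"
        by (intro integrable_continuous_real continuous_intros)
      then show "((\<lambda>y. mode j y * mode (- k) y) has_integral (if j = k then 1 else 0)) {0..1}"
        using fourier_coeff_mode[of j k] by (simp add: has_integral_integral fourier_coeff_conv_mode)
    qed
    moreover have "(\<Sum>j\<in>F. fourier_coeff f j * (if j = k then 1 else 0)) = c k"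
      using F by (simp add: c_def if_distrib cong: if_cong)
    ultimately show ?thesis
      by (auto simp: fourier_coeff_conv_mode s_def sum_distrib_right mult.assoc dest!: integral_unique)
  qed
  \<comment> \<open>Membership of \<open>s\<close> in \<open>H1\<close> makes Parseval available
    with \<open>s\<close> as its first factor.\<close>
  have sH: "s \<in> H1"
  proof (rule in_H1_coeffI[OF sc])
    show "weighted_l2 c"
      by (rule weighted_l2_finite) (use F in \<open>auto simp: c_def intro: finite_subset[of _ F]\<close>)
  qed (auto simp: cs, simp add: s_def H1_periodic[OF H1_mode])
  have n: "0 \<le> integral {0..1} (\<lambda>y. (cmod (f y - s y))\<^sup>2)"
    by (rule integral_nonneg) (auto intro!: integrable_norm_power2 continuous_intros f cs)
  have p: "((\<lambda>k. fourier_coeff s k * cnj (fourier_coeff g k)) has_sum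
      fourier_coeff (\<lambda>y. s y * cnj (g y)) 0) UNIV" if "continuous_on UNIV g" for g
    using has_sum_parseval[OF sH continuous_on_cnj[OF that]] that
    by (simp add: fourier_coeff_cnj)
  have fin: "((\<lambda>k. c k * cnj (d k)) has_sum (\<Sum>k\<in>F. c k * cnj (d k))) UNIV" for d
    by (rule has_sum_finite_neutralI[of F]) (auto simp: F c_def)
  have sf: "fourier_coeff (\<lambda>y. s y * cnj (f y)) 0 = (\<Sum>k\<in>F. of_real ((cmod (fourier_coeff f k))\<^sup>2))"
  proof -
    have "fourier_coeff (\<lambda>y. s y * cnj (f y)) 0 = (\<Sum>k\<in>F. c k * cnj (fourier_coeff f k))"
      using has_sum_unique[OF p[OF f]] fin[of "fourier_coeff f"] by (simp add: sc)
    then show ?thesis by (simp add: c_def complex_norm_square del: of_real_power)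
  qed
  have ss: "fourier_coeff (\<lambda>y. s y * cnj (s y)) 0 = (\<Sum>k\<in>F. of_real ((cmod (fourier_coeff f k))\<^sup>2))"
  proof -
    have "fourier_coeff (\<lambda>y. s y * cnj (s y)) 0 = (\<Sum>k\<in>F. c k * cnj (c k))"
      using has_sum_unique[OF p[OF cs]] fin[of c] by (simp add: sc)
    then show ?thesis by (simp add: c_def complex_norm_square del: of_real_power)
  qed
  \<comment> \<open>Obtained from \<open>sf\<close> by conjugation, since Parseval wants its first
    factor in \<open>H1\<close> and \<open>f\<close> is merely continuous.\<close>
  have fs: "fourier_coeff (\<lambda>y. f y * cnj (s y)) 0 = (\<Sum>k\<in>F. of_real ((cmod (fourier_coeff f k))\<^sup>2))"
    using fourier_coeff_cnj[of "\<lambda>y. s y * cnj (f y)" 0] sf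
      continuous_on_mult[OF cs continuous_on_cnj[OF f]]
    by (simp add: mult.commute)
  note c = f cs continuous_on_cnj[OF f] continuous_on_cnj[OF cs]
  have "complex_of_real (integral {0..1} (\<lambda>y. (cmod (f y - s y))\<^sup>2))
      = fourier_coeff (\<lambda>y. ((f y * cnj (f y) - f y * cnj (s y)) - s y * cnj (f y)) + s y * cnj (s y)) 0"
    by (subst fourier_coeff_norm_power2[symmetric]) (auto intro!: continuous_on_diff c simp: algebra_simps)
  also have "\<dots> = complex_of_real (integral {0..1} (\<lambda>y. (cmod (f y))\<^sup>2) - (\<Sum>k\<in>F. (cmod (fourier_coeff f k))\<^sup>2))"
    by (simp add: fourier_coeff_add fourier_coeff_diff continuous_on_mult continuous_on_diff c fs ss sf
        fourier_coeff_norm_power2 del: of_real_power)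
  finally show ?thesis using n by (simp only: of_real_eq_iff)
qed

section \<open>Characterisation of \<open>H1\<close> by mean-square translation differences\<close>

lemma norm_mode_minus_1: "cmod (mode k h - 1) = 2 * \<bar>sin (pi * of_int k * h)\<bar>"
  using dist_exp_i_1[of "2 * pi * of_int k * h"]
  by (simp add: mode_def cis_conv_exp mult.assoc)

lemma H1_translate_diff:
  assumes f: "f \<in> H1" and h: "0 \<le> h" "h \<le> 1"
  shows "(\<lambda>y. f (y + h) - f y) \<in> H1"
    and "fourier_coeff (\<lambda>y. f (y + h) - f y) k = (mode k h - 1) * fourier_coeff f k"
proof -
  have c: "continuous_on UNIV f" using f by (rule H1_continuous)
  have c': "continuous_on UNIV (\<lambda>y. f (y + h))"
    by (rule continuous_on_compose2[OF c]) (auto intro!: continuous_intros)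
  show fc: "fourier_coeff (\<lambda>y. f (y + h) - f y) k = (mode k h - 1) * fourier_coeff f k" for k
    using fourier_coeff_translate[OF c H1_periodic[OF f] h, of k]
    by (simp add: fourier_coeff_diff[OF c' c] algebra_simps)
  show "(\<lambda>y. f (y + h) - f y) \<in> H1"
  proof (rule in_H1_coeffI[OF fc])
    have "weighted_l2 (\<lambda>k. 2 * fourier_coeff f k)"
      by (rule weighted_l2_cmult) (use f in \<open>simp add: H1_iff\<close>)
    then show "weighted_l2 (\<lambda>k. (mode k h - 1) * fourier_coeff f k)"
    proof (rule weighted_l2_compare)
      fix k
      have "cmod (mode k h - 1) \<le> 2" by (simp add: norm_mode_minus_1)
      then show "cmod ((mode k h - 1) * fourier_coeff f k) \<le> cmod (2 * fourier_coeff f k)"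
        by (simp add: norm_mult mult_right_mono)
    qed
    show "continuous_on UNIV (\<lambda>y. f (y + h) - f y)" by (intro continuous_on_diff c c')
    show "f (y + 1 + h) - f (y + 1) = f (y + h) - f y" for y
      using H1_periodic[OF f, of "y + h"] H1_periodic[OF f, of y] by (simp add: add_ac)
  qed
qed

text \<open>Translation by \<open>h\<close> multiplies coefficient \<open>k\<close> by
  \<open>mode k h\<close>, and \<open>|mode k h - 1| = 2 |sin (pi k h)|\<close> is at most
  \<open>2 pi h |k|\<close>. Plancherel sums these bounds to the weighted norm.\<close>

lemma H1_translate_bound:
  assumes f: "f \<in> H1" and h: "0 \<le> h" "h \<le> 1"
  shows "integral {0..1} (\<lambda>y. (cmod (f (y + h) - f y))\<^sup>2) \<le> (2 * pi * H1_norm f)\<^sup>2 * h\<^sup>2"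
proof -
  have "(\<lambda>k. (cmod (fourier_coeff f k))\<^sup>2 * (weight k)\<^sup>2) summable_on UNIV"
    using f by (simp add: H1_def)
  moreover have "(\<Sum>\<^sub>\<infinity>k. (cmod (fourier_coeff f k))\<^sup>2 * (weight k)\<^sup>2) = (H1_norm f)\<^sup>2"
    by (simp add: H1_norm_def infsum_nonneg)
  ultimately have "((\<lambda>k. (cmod (fourier_coeff f k))\<^sup>2 * (weight k)\<^sup>2) has_sum (H1_norm f)\<^sup>2) UNIV"
    by (simp only: summable_iff_has_sum_infsum)
  then have sum: "((\<lambda>k. (2 * pi * h)\<^sup>2 * ((cmod (fourier_coeff f k))\<^sup>2 * (weight k)\<^sup>2)) has_sum
      (2 * pi * h)\<^sup>2 * (H1_norm f)\<^sup>2) UNIV"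
    by (rule has_sum_cmult_right)
  have "((\<lambda>k. (cmod ((mode k h - 1) * fourier_coeff f k))\<^sup>2) has_sum
      integral {0..1} (\<lambda>y. (cmod (f (y + h) - f y))\<^sup>2)) UNIV"
    using has_sum_plancherel[OF H1_translate_diff(1)[OF assms]]
    by (simp add: H1_translate_diff(2)[OF assms])
  moreover have "(cmod ((mode k h - 1) * fourier_coeff f k))\<^sup>2
      \<le> (2 * pi * h)\<^sup>2 * ((cmod (fourier_coeff f k))\<^sup>2 * (weight k)\<^sup>2)" for k
  proof -
    have "cmod (mode k h - 1) \<le> 2 * \<bar>pi * of_int k * h\<bar>"
      unfolding norm_mode_minus_1 using abs_sin_x_le_abs_x by simp
    also have "\<dots> \<le> 2 * pi * h * weight k"
      using h by (auto simp: weight_def abs_mult)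
    finally have "(cmod (mode k h - 1) * cmod (fourier_coeff f k))\<^sup>2
        \<le> (2 * pi * h * weight k * cmod (fourier_coeff f k))\<^sup>2"
      by (intro power_mono mult_right_mono) auto
    then show ?thesis by (simp add: norm_mult power_mult_distrib mult_ac)
  qed
  ultimately have "integral {0..1} (\<lambda>y. (cmod (f (y + h) - f y))\<^sup>2) \<le> (2 * pi * h)\<^sup>2 * (H1_norm f)\<^sup>2"
    by (rule has_sum_mono[OF _ sum])
  then show ?thesis by (simp add: power_mult_distrib mult_ac)
qed

text \<open>The converse of the translation bound. Bessel on a finite set of frequencies, divided by
  \<open>h^2\<close>, bounds the sum of \<open>(2 pi k)^2 |f_k|^2\<close> by \<open>C\<close> in the
  limit as \<open>h\<close> tends to 0. This gives a test for membership in \<open>H1\<close> that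
  involves no derivative of \<open>f\<close>.\<close>

lemma in_H1_translateI:
  assumes c: "continuous_on UNIV f" and per: "\<And>y. f (y + 1) = f y"
    and bound: "\<And>h. 0 < h \<Longrightarrow> h < 1 \<Longrightarrow> integral {0..1} (\<lambda>y. (cmod (f (y + h) - f y))\<^sup>2) \<le> C * h\<^sup>2"
  shows "f \<in> H1"
proof -
  have lim: "((\<lambda>h. (cmod (mode k h - 1) / h)\<^sup>2) \<longlongrightarrow> (2 * pi * of_int k)\<^sup>2) (at_right 0)" for k
  proof -
    have "((\<lambda>h. sin (pi * of_int k * h)) has_real_derivative pi * of_int k) (at 0)"
      by (auto intro!: derivative_eq_intros)
    then have "((\<lambda>h. sin (pi * of_int k * h) / h) \<longlongrightarrow> pi * of_int k) (at 0)"
      by (simp add: DERIV_def)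
    then have "((\<lambda>h. sin (pi * of_int k * h) / h) \<longlongrightarrow> pi * of_int k) (at_right 0)"
      by (rule tendsto_within_subset) auto
    from tendsto_mult[OF tendsto_const[of 4] tendsto_power[OF this, of 2]]
    show ?thesis
      by (simp add: norm_mode_minus_1 power_divide power_mult_distrib mult.assoc)
  qed
  have F: "(\<Sum>k\<in>F. (2 * pi * of_int k)\<^sup>2 * (cmod (fourier_coeff f k))\<^sup>2) \<le> C" if "finite F" for F :: "int set"
  proof (rule tendsto_upperbound)
    show "((\<lambda>h. \<Sum>k\<in>F. (cmod (mode k h - 1) / h)\<^sup>2 * (cmod (fourier_coeff f k))\<^sup>2)
        \<longlongrightarrow> (\<Sum>k\<in>F. (2 * pi * of_int k)\<^sup>2 * (cmod (fourier_coeff f k))\<^sup>2)) (at_right 0)"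
      by (intro tendsto_sum tendsto_mult lim tendsto_const)
    have "(\<Sum>k\<in>F. (cmod (mode k h - 1) / h)\<^sup>2 * (cmod (fourier_coeff f k))\<^sup>2) \<le> C"
      if h: "0 < h" "h < 1" for h
    proof -
      have c': "continuous_on UNIV (\<lambda>y. f (y + h))"
        by (rule continuous_on_compose2[OF c]) (auto intro!: continuous_intros)
      have fc: "fourier_coeff (\<lambda>y. f (y + h) - f y) k = (mode k h - 1) * fourier_coeff f k" for k
        using fourier_coeff_translate[OF c per, of h k] h
        by (simp add: fourier_coeff_diff[OF c' c] algebra_simps)
      have "(\<Sum>k\<in>F. (cmod ((mode k h - 1) * fourier_coeff f k))\<^sup>2) \<le> C * h\<^sup>2"
        using order_trans[OF bessel[OF continuous_on_diff[OF c' c] \<open>finite F\<close>] bound[OF h]]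
        by (simp add: fc)
      then have "(\<Sum>k\<in>F. (cmod ((mode k h - 1) * fourier_coeff f k))\<^sup>2) / h\<^sup>2 \<le> C"
        using h by (simp add: pos_divide_le_eq)
      then show ?thesis
        by (simp add: sum_divide_distrib norm_mult power_mult_distrib power_divide)
    qed
    then show "\<forall>\<^sub>F h in at_right 0. (\<Sum>k\<in>F. (cmod (mode k h - 1) / h)\<^sup>2 * (cmod (fourier_coeff f k))\<^sup>2) \<le> C"
      unfolding eventually_at_right_field by (auto intro!: exI[of _ 1])
  qed simp
  have "(\<lambda>k. (2 * pi * of_int k)\<^sup>2 * (cmod (fourier_coeff f k))\<^sup>2) summable_on UNIV"
    by (rule nonneg_bdd_above_summable_on) (auto intro!: bdd_aboveI2[of _ _ C] F)
  \<comment> \<open>Translation differences do not see the frequency 0, whose weight is 1, so its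
    term is added separately.\<close>
  moreover have "(\<lambda>k. if k = 0 then (cmod (fourier_coeff f k))\<^sup>2 else 0) summable_on (UNIV :: int set)"
    by (rule summable_on_cong_neutral[THEN iffD1, OF _ _ _ summable_on_finite[of "{0}"]]) auto
  ultimately have "(\<lambda>k. (2 * pi * of_int k)\<^sup>2 * (cmod (fourier_coeff f k))\<^sup>2
      + (if k = 0 then (cmod (fourier_coeff f k))\<^sup>2 else 0)) summable_on UNIV"
    by (rule summable_on_add)
  then have "weighted_l2 (fourier_coeff f)"
    unfolding weighted_l2_def
  proof (rule summable_on_comparison_test)
    fix k
    \<comment> \<open>The factor \<open>(2 * pi)^2\<close> is at least 1, so the terms just summed
      dominate the weighted ones away from \<open>k = 0\<close>.\<close>
    have "1 * 1 \<le> (2 * pi) * (2 * pi)" using pi_gt3 by (intro mult_mono) auto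
    then have "(cmod (fourier_coeff f k) * of_int k)\<^sup>2 * 1 \<le> (cmod (fourier_coeff f k) * of_int k)\<^sup>2 * (2 * pi)\<^sup>2"
      by (intro mult_left_mono) (auto simp: power2_eq_square)
    then show "(cmod (fourier_coeff f k))\<^sup>2 * (weight k)\<^sup>2 \<le> (2 * pi * of_int k)\<^sup>2 * (cmod (fourier_coeff f k))\<^sup>2
      + (if k = 0 then (cmod (fourier_coeff f k))\<^sup>2 else 0)"
      by (simp add: weight_def power_mult_distrib mult_ac)
  qed auto
  then show ?thesis using c per by (simp add: H1_iff)
qed

text \<open>The translation differences of \<open>u\<close> inherit the quadratic bound from those
  of \<open>f\<close> and \<open>g\<close> through \<open>(a + b)^2 \<le> 2 (a^2 + b^2)\<close>.
  Closure of \<open>H1\<close> under products and inverses thereby reduces to a pointwise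
  estimate.\<close>

lemma in_H1_lipschitzI:
  assumes f: "f \<in> H1" and g: "g \<in> H1" and c: "continuous_on UNIV u" and per: "\<And>y. u (y + 1) = u y"
    and lip: "\<And>x y. cmod (u x - u y) \<le> K * (cmod (f x - f y) + cmod (g x - g y))"
  shows "u \<in> H1"
proof (rule in_H1_translateI[OF c per])
  fix h :: real assume h: "0 < h" "h < 1"
  have ct: "continuous_on UNIV (\<lambda>y. v (y + h) - v y)" if "continuous_on UNIV v" for v :: "real \<Rightarrow> complex"
    by (intro continuous_on_diff that continuous_on_compose2[OF that]) (auto intro!: continuous_intros)
  note i = integrable_norm_power2[OF ct, of _ 0 1]
  note fg = H1_continuous[OF f] H1_continuous[OF g]
  let ?D = "\<lambda>v y. (cmod (v (y + h) - v y))\<^sup>2"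
  have "integral {0..1} (?D u) \<le> integral {0..1} (\<lambda>y. 2 * K\<^sup>2 * (?D f y + ?D g y))"
  proof (rule integral_le)
    show "?D u integrable_on {0..1}" by (rule i[OF c])
    show "(\<lambda>y. 2 * K\<^sup>2 * (?D f y + ?D g y)) integrable_on {0..1}"
      by (intro integrable_on_mult_right integrable_add i fg)
    show "?D u y \<le> 2 * K\<^sup>2 * (?D f y + ?D g y)" for y
    proof -
      let ?a = "cmod (f (y + h) - f y)" and ?b = "cmod (g (y + h) - g y)"
      have "?D u y \<le> (K * (?a + ?b))\<^sup>2"
        using lip[of "y + h" y] by (intro power_mono) auto
      also have "\<dots> \<le> K\<^sup>2 * (2 * (?a\<^sup>2 + ?b\<^sup>2))"
        unfolding power_mult_distrib
        using sum_squares_bound[of ?a ?b] by (intro mult_left_mono) (auto simp: power2_sum)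
      finally show ?thesis by (simp add: algebra_simps)
    qed
  qed
  also have "\<dots> = 2 * K\<^sup>2 * (integral {0..1} (?D f) + integral {0..1} (?D g))"
    by (simp add: integral_add[OF i[OF fg(1)] i[OF fg(2)]])
  also have "\<dots> \<le> 2 * K\<^sup>2 * ((2 * pi * H1_norm f)\<^sup>2 * h\<^sup>2 + (2 * pi * H1_norm g)\<^sup>2 * h\<^sup>2)"
    using h by (intro mult_left_mono add_mono H1_translate_bound f g) auto
  finally show "integral {0..1} (?D u)
      \<le> (2 * K\<^sup>2 * ((2 * pi * H1_norm f)\<^sup>2 + (2 * pi * H1_norm g)\<^sup>2)) * h\<^sup>2"
    by (simp add: algebra_simps)
qed

section \<open>Products and quotients in \<open>H1\<close>\<close>

lemma periodic_range:
  fixes f :: "real \<Rightarrow> complex"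
  assumes "\<And>y. f (y + 1) = f y"
  shows "range f = f ` {0..1}"
proof -
  have "f y = f (frac y)" for y
    using periodic_shift_int[of f, OF assms, of "frac y" "\<lfloor>y\<rfloor>"] by (simp add: frac_def)
  moreover have "frac y \<in> {0..1}" for y :: real
    using frac_ge_0[of y] frac_lt_1[of y] by simp
  ultimately show ?thesis by blast
qed

lemma H1_compact_range: "f \<in> H1 \<Longrightarrow> compact (range f)"
  using periodic_range[of f] compact_continuous_image[of "{0..1}" f]
    continuous_on_subset[OF H1_continuous, of f "{0..1}"]
  by (auto simp: H1_periodic)

lemma H1_bounded:
  assumes "f \<in> H1"
  obtains M where "M > 0" "\<And>y. cmod (f y) \<le> M"
  using compact_imp_bounded[OF H1_compact_range[OF assms]] bounded_pos by (metis rangeI)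

lemma H1_nonzero_lower_bound:
  assumes "f \<in> H1" "\<And>y. f y \<noteq> 0"
  obtains c where "c > 0" "\<And>y. cmod (f y) \<ge> c"
proof -
  have "0 \<notin> range f" using assms(2) by auto
  \<comment> \<open>The range is compact, hence closed, so its distance from 0 serves as the lower
    bound.\<close>
  then have "0 < infdist 0 (range f)"
    using compact_imp_closed[OF H1_compact_range[OF assms(1)]]
    by (simp add: infdist_pos_not_in_closed)
  moreover have "infdist 0 (range f) \<le> cmod (f y)" for y
    using infdist_le[of "f y" "range f" 0] by simp
  ultimately show ?thesis using that by blast
qed

lemma H1_mult:
  assumes f: "f \<in> H1" and g: "g \<in> H1"
  shows "(\<lambda>y. f y * g y) \<in> H1"
proof -
  obtain M where M: "M > 0" "\<And>y. cmod (f y) \<le> M" using H1_bounded[OF f] by blast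
  obtain N where N: "N > 0" "\<And>y. cmod (g y) \<le> N" using H1_bounded[OF g] by blast
  show ?thesis
  proof (rule in_H1_lipschitzI[OF f g])
    show "cmod (f x * g x - f y * g y) \<le> (M + N) * (cmod (f x - f y) + cmod (g x - g y))" for x y
    proof -
      have "f x * g x - f y * g y = (f x - f y) * g x + f y * (g x - g y)" by (simp add: algebra_simps)
      then have "cmod (f x * g x - f y * g y) \<le> cmod (f x - f y) * cmod (g x) + cmod (f y) * cmod (g x - g y)"
        by (metis norm_mult norm_triangle_ineq)
      also have "\<dots> \<le> cmod (f x - f y) * (M + N) + (M + N) * cmod (g x - g y)"
        using M N by (intro add_mono mult_left_mono mult_right_mono) (auto intro: add_increasing add_increasing2 less_imp_le)
      finally show ?thesis by (simp add: algebra_simps)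
    qed
  qed (use H1_periodic[OF f] H1_periodic[OF g] in
      \<open>auto intro!: continuous_on_mult H1_continuous[OF f] H1_continuous[OF g]\<close>)
qed

lemma H1_divide:
  assumes f: "f \<in> H1" and g: "g \<in> H1" and nz: "\<And>y. g y \<noteq> 0"
  shows "(\<lambda>y. f y / g y) \<in> H1"
proof -
  obtain c where c: "c > 0" "\<And>y. c \<le> cmod (g y)" using H1_nonzero_lower_bound[OF g nz] by blast
  \<comment> \<open>On values of modulus at least \<open>c\<close>, inversion is Lipschitz with
    constant \<open>(inverse c)^2\<close>. The criterion takes two functions, and \<open>g\<close>
    fills both slots.\<close>
  have "(\<lambda>y. inverse (g y)) \<in> H1"
  proof (rule in_H1_lipschitzI[OF g g])
    show "cmod (inverse (g x) - inverse (g y)) \<le> (inverse c)\<^sup>2 * (cmod (g x - g y) + cmod (g x - g y))" for x y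
    proof -
      have le: "cmod (inverse (g z)) \<le> inverse c" for z
        using c by (simp add: norm_inverse le_imp_inverse_le)
      have "inverse (g x) - inverse (g y) = - (inverse (g x) * (g x - g y) * inverse (g y))"
        by (rule inverse_diff_inverse) (auto simp: nz)
      then have "cmod (inverse (g x) - inverse (g y))
          = cmod (inverse (g x)) * cmod (inverse (g y)) * cmod (g x - g y)"
        by (simp add: norm_mult)
      also have "\<dots> \<le> inverse c * inverse c * cmod (g x - g y)"
        using c by (intro mult_right_mono mult_mono le) auto
      also have "\<dots> \<le> inverse c * inverse c * (cmod (g x - g y) + cmod (g x - g y))"
        using c by (intro mult_left_mono) auto
      finally show ?thesis by (simp add: power2_eq_square)
    qed
  qed (use H1_periodic[OF g] nz in \<open>auto intro!: continuous_on_inverse H1_continuous[OF g]\<close>)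
  from H1_mult[OF f this] show ?thesis by (simp add: divide_inverse)
qed

section \<open>Frequency supports\<close>

text \<open>For \<open>S = {1..}\<close> this is the space of the phase variables as functions. The
  brackets are handled with half-lines \<open>S\<close>, because products add frequencies.\<close>

definition H1_supp :: "int set \<Rightarrow> (real \<Rightarrow> complex) set" where
  "H1_supp S = {f \<in> H1. \<forall>k. k \<notin> S \<longrightarrow> fourier_coeff f k = 0}"

lemma H1_supp_H1: "f \<in> H1_supp S \<Longrightarrow> f \<in> H1"
  by (simp add: H1_supp_def)

lemma H1_supp_coeff: "f \<in> H1_supp S \<Longrightarrow> k \<notin> S \<Longrightarrow> fourier_coeff f k = 0"
  by (simp add: H1_supp_def)

lemma H1_supp_diff: "f \<in> H1_supp S \<Longrightarrow> g \<in> H1_supp S \<Longrightarrow> (\<lambda>y. f y - g y) \<in> H1_supp S"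
  by (simp add: H1_supp_def H1_diff fourier_coeff_diff H1_continuous)

lemma H1_supp_cmult: "f \<in> H1_supp S \<Longrightarrow> (\<lambda>y. c * f y) \<in> H1_supp S"
  by (simp add: H1_supp_def H1_cmult fourier_coeff_cmult)

text \<open>Coefficient \<open>k\<close> of the product is a convolution over \<open>j\<close>. If
  \<open>k\<close> lies outside \<open>R\<close>, each term has \<open>j\<close> outside
  \<open>S\<close> or \<open>k - j\<close> outside \<open>T\<close>.\<close>

lemma H1_supp_multI:
  assumes f: "f \<in> H1_supp S" and g: "g \<in> H1_supp T"
    and "\<And>j k. j \<in> S \<Longrightarrow> k \<in> T \<Longrightarrow> j + k \<in> R"
  shows "(\<lambda>y. f y * g y) \<in> H1_supp R"
proof -
  have "fourier_coeff (\<lambda>y. f y * g y) k = 0" if "k \<notin> R" for k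
  proof -
    have "(\<lambda>j. fourier_coeff f j * fourier_coeff g (k - j)) = (\<lambda>j. 0)"
    proof
      fix j
      have "j \<notin> S \<or> k - j \<notin> T" using assms(3)[of j "k - j"] that by auto
      then show "fourier_coeff f j * fourier_coeff g (k - j) = 0"
        using H1_supp_coeff[OF f] H1_supp_coeff[OF g] by auto
    qed
    with has_sum_convolution[OF H1_supp_H1[OF f] H1_continuous[OF H1_supp_H1[OF g]], of k]
    show ?thesis using has_sum_unique[OF _ has_sum_0[of UNIV "\<lambda>j. 0"]] by simp
  qed
  then show ?thesis using H1_mult[OF H1_supp_H1[OF f] H1_supp_H1[OF g]] by (simp add: H1_supp_def)
qed

lemmas H1_supp_mult_pos = H1_supp_multI[where S = "{a..}" and T = "{b..}" and R = "{c..}" for a b c]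
lemmas H1_supp_mult_neg = H1_supp_multI[where S = "{..a}" and T = "{..b}" and R = "{..c}" for a b c]

section \<open>Fourier projections and negative-frequency parts\<close>

definition fproj :: "int set \<Rightarrow> (real \<Rightarrow> complex) \<Rightarrow> real \<Rightarrow> complex" where
  "fproj S f = fourier_series (\<lambda>k. if k \<in> S then fourier_coeff f k else 0)"

lemma
  assumes "f \<in> H1"
  shows fourier_coeff_fproj: "fourier_coeff (fproj S f) k = (if k \<in> S then fourier_coeff f k else 0)"
    and fproj_H1: "fproj S f \<in> H1"
proof -
  have "weighted_l2 (\<lambda>k. if k \<in> S then fourier_coeff f k else 0)"
    by (rule weighted_l2_compare[of "fourier_coeff f"]) (use assms in \<open>auto simp: H1_iff\<close>)
  then show "fourier_coeff (fproj S f) k = (if k \<in> S then fourier_coeff f k else 0)" "fproj S f \<in> H1"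
    unfolding fproj_def
    by (auto intro: fourier_series_in_H1 simp: fourier_coeff_fourier_series[OF weighted_l2_abs_summable])
qed

lemma fproj_H1_supp: "f \<in> H1 \<Longrightarrow> fproj S f \<in> H1_supp S"
  by (simp add: H1_supp_def fproj_H1 fourier_coeff_fproj)

lemma fproj_compl_H1_supp:
  assumes "f \<in> H1"
  shows "(\<lambda>y. f y - fproj {1..} f y) \<in> H1_supp {..0}"
    and "(\<lambda>y. f y - fproj {..- 1} f y) \<in> H1_supp {0..}"
  using assms
  by (auto simp: H1_supp_def H1_diff fproj_H1 fourier_coeff_fproj fourier_coeff_diff H1_continuous)

lemma proj_plus_eq: "proj_plus f = fproj {0..} f"
  by (auto simp: fun_eq_iff proj_plus_def fproj_def fourier_series_def intro!: infsum_cong_neutral split: if_splits)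

lemma proj_plus0_eq: "proj_plus0 f = fproj {1..} f"
  by (auto simp: fun_eq_iff proj_plus0_def fproj_def fourier_series_def intro!: infsum_cong_neutral split: if_splits)

text \<open>Positivity of both frequencies leaves only \<open>1 \<le> i < m\<close> in the
  convolution. This finiteness is what makes the integrals polynomial in finitely many
  coefficients.\<close>

lemma fourier_coeff_mult_pos:
  assumes f: "f \<in> H1_supp {1..}" and g: "g \<in> H1_supp {1..}"
  shows "fourier_coeff (\<lambda>y. f y * g y) m = (\<Sum>i\<in>{1..<m}. fourier_coeff f i * fourier_coeff g (m - i))"
proof -
  have "((\<lambda>i. fourier_coeff f i * fourier_coeff g (m - i)) has_sum
      (\<Sum>i\<in>{1..<m}. fourier_coeff f i * fourier_coeff g (m - i))) UNIV"
    by (rule has_sum_finite_neutralI[of "{1..<m}"])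
      (use H1_supp_coeff[OF f] H1_supp_coeff[OF g] in auto)
  with has_sum_convolution[OF H1_supp_H1[OF f] H1_continuous[OF H1_supp_H1[OF g]], of m]
  show ?thesis by (rule has_sum_unique)
qed

lemma fourier_coeff_H1_add: "f \<in> H1 \<Longrightarrow> g \<in> H1 \<Longrightarrow>
    fourier_coeff (\<lambda>y. f y + g y) k = fourier_coeff f k + fourier_coeff g k"
  by (intro fourier_coeff_add H1_continuous)

lemma fourier_coeff_H1_diff: "f \<in> H1 \<Longrightarrow> g \<in> H1 \<Longrightarrow>
    fourier_coeff (\<lambda>y. f y - g y) k = fourier_coeff f k - fourier_coeff g k"
  by (intro fourier_coeff_diff H1_continuous)

lemma mean_pos: "f \<in> H1_supp {1..} \<Longrightarrow> fourier_coeff f 0 = 0"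
  by (simp add: H1_supp_coeff)

lemma mean_neg: "f \<in> H1_supp {..- 1} \<Longrightarrow> fourier_coeff f 0 = 0"
  by (simp add: H1_supp_coeff)

text \<open>The part that \<open>\<Pi>\<^sup>+\<close> discards from the \<open>m\<close>-fold shift
  of \<open>g\<close>. Applied to \<open>u\<close> and \<open>W\<close> it gives \<alpha> and
  \<psi>.\<close>

definition lowpass :: "int \<Rightarrow> (real \<Rightarrow> complex) \<Rightarrow> real \<Rightarrow> complex" where
  "lowpass m g = fproj {..- 1} (\<lambda>y. mode (- m) y * g y)"

lemma lowpass_supp:
  assumes "g \<in> H1"
  shows "lowpass m g \<in> H1_supp {..- 1}" and "(\<lambda>y. mode (- m) y * g y - lowpass m g y) \<in> H1_supp {0..}"
proof -
  have "(\<lambda>y. mode (- m) y * g y) \<in> H1" by (intro H1_mult H1_mode assms)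
  from fproj_H1_supp[OF this] fproj_compl_H1_supp(2)[OF this]
  show "lowpass m g \<in> H1_supp {..- 1}" "(\<lambda>y. mode (- m) y * g y - lowpass m g y) \<in> H1_supp {0..}"
    by (auto simp: lowpass_def)
qed

text \<open>The frequency sets \<open>{0..}\<close> and \<open>{..- 1}\<close> are complementary, so
  all coefficients of the difference cancel.\<close>

lemma proj_plus_lowpass:
  assumes "g \<in> H1"
  shows "proj_plus (\<lambda>y. mode (- m) y * g y) y = mode (- m) y * g y - lowpass m g y"
proof -
  let ?g = "\<lambda>y. mode (- m) y * g y"
  have g: "?g \<in> H1" by (intro H1_mult H1_mode assms)
  let ?d = "\<lambda>y. ?g y - lowpass m g y - fproj {0..} ?g y"
  have d: "?d \<in> H1" unfolding lowpass_def by (intro H1_diff fproj_H1 g)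
  have "?d = (\<lambda>y. 0)"
  proof (rule fourier_unique)
    show "fourier_coeff ?d k = 0" for k
      by (simp add: lowpass_def fourier_coeff_H1_diff H1_diff fproj_H1 g fourier_coeff_fproj)
  qed (use H1_continuous[OF d] H1_periodic[OF d] in auto)
  then show ?thesis by (simp add: proj_plus_eq fun_eq_iff)
qed

text \<open>In the mean, the negative frequencies of \<open>lowpass m g\<close> meet only the
  positive part \<open>N'\<close> of \<open>N\<close>. Replacing \<open>lowpass m g\<close> by
  \<open>mode (- m) * g\<close> then changes the product by positive frequencies alone, which leaves
  coefficient \<open>m\<close> of \<open>g * N'\<close>, a finite convolution.\<close>

lemma fourier_coeff_lowpass_mult:
  assumes g: "g \<in> H1_supp {1..}" and N: "N \<in> H1"
  shows "fourier_coeff (\<lambda>y. lowpass m g y * N y) 0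
    = (\<Sum>i\<in>{1..<m}. fourier_coeff g i * fourier_coeff N (m - i))"
proof -
  note gH = H1_supp_H1[OF g]
  define N' where "N' = fproj {1..} N"
  have N': "N' \<in> H1_supp {1..}" "N' \<in> H1" "(\<lambda>y. N y - N' y) \<in> H1_supp {..0}"
    unfolding N'_def using fproj_H1_supp[OF N] fproj_H1[OF N] fproj_compl_H1_supp(1)[OF N]
    by auto
  have l: "lowpass m g \<in> H1" using H1_supp_H1[OF lowpass_supp(1)[OF gH]] .
  note H = l gH N N'(2) H1_mode H1_mult H1_diff
  have 1: "fourier_coeff (\<lambda>y. lowpass m g y * (N y - N' y)) 0 = 0"
    by (rule mean_neg, rule H1_supp_mult_neg[OF lowpass_supp(1)[OF gH] N'(3)]) auto
  have 2: "fourier_coeff (\<lambda>y. (mode (- m) y * g y - lowpass m g y) * N' y) 0 = 0"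
    by (rule mean_pos, rule H1_supp_mult_pos[OF lowpass_supp(2)[OF gH] N'(1)]) auto
  have "fourier_coeff (\<lambda>y. lowpass m g y * N y) 0 = fourier_coeff (\<lambda>y. lowpass m g y * (N y - N' y)
      + (mode (- m) y * (g y * N' y) - (mode (- m) y * g y - lowpass m g y) * N' y)) 0"
    by (simp add: algebra_simps)
  also have "\<dots> = fourier_coeff (\<lambda>y. g y * N' y) m"
    by (simp add: fourier_coeff_H1_add fourier_coeff_H1_diff H 1 2 fourier_coeff_mode_mult)
  also have "\<dots> = (\<Sum>i\<in>{1..<m}. fourier_coeff g i * fourier_coeff N' (m - i))"
    by (rule fourier_coeff_mult_pos[OF g N'(1)])
  \<comment> \<open>In this range \<open>m - i\<close> is at least 1, where \<open>N\<close> and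
    \<open>N'\<close> have the same coefficients.\<close>
  also have "\<dots> = (\<Sum>i\<in>{1..<m}. fourier_coeff g i * fourier_coeff N (m - i))"
    by (rule sum.cong) (auto simp: N'_def fourier_coeff_fproj[OF N])
  finally show ?thesis .
qed

section \<open>The algebra behind the brackets\<close>

text \<open>\<open>P\<close> stands for the reflected momentum. Reflection turns the bilinear
  pairing with \<open>p\<close> into the mean of a product with \<open>P\<close>, and it moves the
  frequencies of \<open>p\<close> to the negative side.\<close>

locale phase_point =
  fixes f W P :: "real \<Rightarrow> complex"
  assumes f: "f \<in> H1" and W: "W \<in> H1_supp {1..}" and P: "P \<in> H1_supp {..- 1}"
    and W_nz: "\<And>y. W y \<noteq> 0"
begin

definition u :: "real \<Rightarrow> complex" where "u = fproj {1..} (\<lambda>y. W y * P y)"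
definition v :: "real \<Rightarrow> complex" where "v y = W y * P y - u y"
definition kap :: "real \<Rightarrow> complex" where "kap y = W y * (P y)\<^sup>2 + f y / W y"
definition G :: "real \<Rightarrow> complex" where "G = fproj {1..} kap"
definition R :: "real \<Rightarrow> complex" where "R y = kap y - G y"
definition \<alpha> :: "int \<Rightarrow> real \<Rightarrow> complex" where "\<alpha> m = lowpass m u"
definition \<psi> :: "int \<Rightarrow> real \<Rightarrow> complex" where "\<psi> m = lowpass m W"

text \<open>The \<open>grad_p\<close> functions are the gradients in \<open>p\<close> themselves.
  The \<open>grad_w\<close> functions act by duality: the mean of their product with the variation
  of \<open>w\<close> is the differential, so their coefficient \<open>- k\<close> is coefficient
  \<open>k\<close> of the gradient for positive \<open>k\<close>.\<close>

definition grad_p_H :: "real \<Rightarrow> complex" where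
  "grad_p_H y = 2 * u y"
definition grad_w_H :: "real \<Rightarrow> complex" where
  "grad_w_H y = (P y)\<^sup>2 - f y / (W y)\<^sup>2"
definition grad_p_J :: "int \<Rightarrow> real \<Rightarrow> complex" where
  "grad_p_J m y = 2 * (W y * \<alpha> m y - u y * \<psi> m y)"
definition grad_w_J :: "int \<Rightarrow> real \<Rightarrow> complex" where
  "grad_w_J m y = 2 * \<alpha> m y * P y - \<psi> m y * grad_w_H y - mode (- m) y * G y"

lemma WH: "W \<in> H1" and PH: "P \<in> H1"
  using W P by (auto intro: H1_supp_H1)

lemma WPH: "(\<lambda>y. W y * P y) \<in> H1"
  by (intro H1_mult WH PH)

lemma P2H: "(\<lambda>y. (P y)\<^sup>2) \<in> H1"
  unfolding power2_eq_square by (intro H1_mult PH)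

lemma kapH: "kap \<in> H1"
  unfolding kap_def[abs_def] by (intro H1_add H1_mult H1_divide WH P2H f W_nz)

lemma u_supp: "u \<in> H1_supp {1..}"
  unfolding u_def by (rule fproj_H1_supp[OF WPH])

lemma v_supp: "v \<in> H1_supp {..0}"
  unfolding v_def[abs_def] u_def using fproj_compl_H1_supp(1)[OF WPH] .

lemma G_supp: "G \<in> H1_supp {1..}"
  unfolding G_def by (rule fproj_H1_supp[OF kapH])

lemma R_supp: "R \<in> H1_supp {..0}"
  unfolding R_def[abs_def] G_def using fproj_compl_H1_supp(1)[OF kapH] .

lemmas base_H1 = f WH PH P2H kapH u_supp[THEN H1_supp_H1] v_supp[THEN H1_supp_H1]
  G_supp[THEN H1_supp_H1] R_supp[THEN H1_supp_H1]

lemma \<alpha>_supp: "\<alpha> m \<in> H1_supp {..- 1}" "(\<lambda>y. mode (- m) y * u y - \<alpha> m y) \<in> H1_supp {0..}"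
  unfolding \<alpha>_def by (intro lowpass_supp base_H1)+

lemma \<psi>_supp: "\<psi> m \<in> H1_supp {..- 1}" "(\<lambda>y. mode (- m) y * W y - \<psi> m y) \<in> H1_supp {0..}"
  unfolding \<psi>_def by (intro lowpass_supp base_H1)+

text \<open>Adding and subtracting \<open>mode (- m) y * u y * W y\<close> trades the negative parts
  for the complementary nonnegative ones. In this form every factor is supported on nonnegative
  frequencies, and \<open>u\<close> and \<open>W\<close> on positive ones.\<close>

lemma grad_p_J_alt:
  "grad_p_J m y = 2 * (u y * (mode (- m) y * W y - \<psi> m y) - W y * (mode (- m) y * u y - \<alpha> m y))"
  by (simp add: grad_p_J_def algebra_simps)

lemma grad_p_J_supp: "grad_p_J m \<in> H1_supp {1..}"
  unfolding grad_p_J_alt[abs_def]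
  by (intro H1_supp_cmult H1_supp_diff
      H1_supp_mult_pos[OF u_supp \<psi>_supp(2)] H1_supp_mult_pos[OF W \<alpha>_supp(2)]) auto

lemma grad_p_H_supp: "grad_p_H \<in> H1_supp {1..}"
  unfolding grad_p_H_def[abs_def] by (intro H1_supp_cmult u_supp)

lemma quotient_H1: "(\<lambda>y. f y / (W y)\<^sup>2) \<in> H1"
  unfolding power2_eq_square by (intro H1_divide f H1_mult WH) (simp add: W_nz)

lemma grad_w_H_H1: "grad_w_H \<in> H1"
  unfolding grad_w_H_def[abs_def] by (intro H1_diff P2H quotient_H1)

lemmas \<alpha>\<psi>_H1 = \<alpha>_supp(1)[THEN H1_supp_H1] \<psi>_supp(1)[THEN H1_supp_H1]

lemma grad_w_J_H1: "grad_w_J m \<in> H1"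
  unfolding grad_w_J_def[abs_def]
  by (intro H1_diff H1_mult H1_cmult base_H1 \<alpha>\<psi>_H1 grad_w_H_H1 H1_mode)

section \<open>Cancellation in the Poisson brackets\<close>

lemma R_2vP_supp: "(\<lambda>y. R y - 2 * (v y * P y)) \<in> H1_supp {..0}"
  by (intro H1_supp_diff H1_supp_cmult R_supp H1_supp_mult_neg[OF v_supp P]) auto

text \<open>The left side is \<open>2 W P^2 - kap\<close>; substitute \<open>W P = u + v\<close> and
  \<open>kap = G + R\<close>. What is added to \<open>2 u P\<close> separates into \<open>G\<close>,
  with positive frequencies, and \<open>R - 2 v P\<close>, with nonpositive ones.\<close>

lemma W_grad_w_H: "W y * grad_w_H y = 2 * u y * P y - (G y + R y - 2 * (v y * P y))"
  using W_nz[of y]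
  by (simp add: grad_w_H_def v_def R_def kap_def field_simps power2_eq_square)

text \<open>The \<psi> terms cancel, and \<open>W_grad_w_H\<close> replaces
  \<open>2 u P - W grad_w_H\<close> by \<open>G + R - 2 v P\<close>. Then \<alpha> times
  \<open>R - 2 v P\<close> has negative frequencies only, while the \<open>G\<close> terms combine
  to \<open>G\<close> times the nonnegative part of \<open>mode (- m) * u\<close>.\<close>

lemma bracket_H_J:
  "fourier_coeff (\<lambda>y. grad_p_H y * grad_w_J m y) 0 - fourier_coeff (\<lambda>y. grad_w_H y * grad_p_J m y) 0 = 0"
proof -
  have "(\<lambda>y. grad_p_H y * grad_w_J m y - grad_w_H y * grad_p_J m y)
      = (\<lambda>y. 2 * (\<alpha> m y * (R y - 2 * (v y * P y))) - 2 * (G y * (mode (- m) y * u y - \<alpha> m y)))"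
  proof
    fix y
    have "grad_p_H y * grad_w_J m y - grad_w_H y * grad_p_J m y
      = 2 * (\<alpha> m y * (2 * u y * P y - W y * grad_w_H y) - mode (- m) y * u y * G y)"
      by (simp add: grad_p_H_def grad_w_J_def grad_p_J_def algebra_simps)
    then show "grad_p_H y * grad_w_J m y - grad_w_H y * grad_p_J m y
        = 2 * (\<alpha> m y * (R y - 2 * (v y * P y))) - 2 * (G y * (mode (- m) y * u y - \<alpha> m y))"
      unfolding W_grad_w_H by (simp add: algebra_simps)
  qed
  moreover have n: "(\<lambda>y. 2 * (\<alpha> m y * (R y - 2 * (v y * P y)))) \<in> H1_supp {..- 1}"
    by (intro H1_supp_cmult H1_supp_mult_neg[OF \<alpha>_supp(1) R_2vP_supp]) auto
  moreover have p: "(\<lambda>y. 2 * (G y * (mode (- m) y * u y - \<alpha> m y))) \<in> H1_supp {1..}"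
    by (intro H1_supp_cmult H1_supp_mult_pos[OF G_supp \<alpha>_supp(2)]) auto
  ultimately have "fourier_coeff (\<lambda>y. grad_p_H y * grad_w_J m y - grad_w_H y * grad_p_J m y) 0 = 0"
    by (simp add: fourier_coeff_H1_diff H1_supp_H1[OF n] H1_supp_H1[OF p] mean_neg[OF n] mean_pos[OF p])
  then show ?thesis
    by (simp add: fourier_coeff_H1_diff H1_mult grad_w_H_H1 grad_w_J_H1
        H1_supp_H1[OF grad_p_H_supp] H1_supp_H1[OF grad_p_J_supp])
qed

text \<open>Antisymmetry in \<open>m\<close> and \<open>n\<close> cancels the terms quadratic in
  \<alpha> and those quadratic in \<psi>. What remains next to \<open>G\<close> is \<delta> times
  the combination treated by \<open>W_grad_w_H\<close>, and the integrand again splits into two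
  one-sided functions.\<close>

lemma bracket_J_J:
  "fourier_coeff (\<lambda>y. grad_p_J m y * grad_w_J n y) 0 - fourier_coeff (\<lambda>y. grad_w_J m y * grad_p_J n y) 0 = 0"
proof -
  \<comment> \<open>\<delta> antisymmetrises the negative parts and \<epsilon> the complementary
    nonnegative parts. In \<epsilon> the products of the full shifts of \<open>u\<close> and
    \<open>W\<close> cancel, so \<open>\<epsilon> - \<delta>\<close> consists of the mixed terms,
    which are exactly those that multiply \<open>2 * G\<close> in the bracket.\<close>
  define \<delta> where "\<delta> y = \<alpha> m y * \<psi> n y - \<alpha> n y * \<psi> m y" for y
  define \<epsilon> where "\<epsilon> y = (mode (- m) y * u y - \<alpha> m y) * (mode (- n) y * W y - \<psi> n y)
    - (mode (- n) y * u y - \<alpha> n y) * (mode (- m) y * W y - \<psi> m y)" for y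
  have \<delta>: "\<delta> \<in> H1_supp {..- 1}"
    unfolding \<delta>_def[abs_def]
    by (intro H1_supp_diff H1_supp_mult_neg[OF \<alpha>_supp(1) \<psi>_supp(1)]) auto
  have \<epsilon>: "\<epsilon> \<in> H1_supp {0..}"
    unfolding \<epsilon>_def[abs_def]
    by (intro H1_supp_diff H1_supp_mult_pos[OF \<alpha>_supp(2) \<psi>_supp(2)]) auto
  have "(\<lambda>y. grad_p_J m y * grad_w_J n y - grad_w_J m y * grad_p_J n y)
      = (\<lambda>y. 2 * (\<delta> y * (R y - 2 * (v y * P y))) + 2 * (G y * \<epsilon> y))"
  proof
    fix y
    have "grad_p_J m y * grad_w_J n y - grad_w_J m y * grad_p_J n y
      = 2 * (\<delta> y * (2 * u y * P y - W y * grad_w_H y) + G y * (\<epsilon> y - \<delta> y))"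
      by (simp add: \<delta>_def \<epsilon>_def grad_w_J_def grad_p_J_def algebra_simps)
    then show "grad_p_J m y * grad_w_J n y - grad_w_J m y * grad_p_J n y
        = 2 * (\<delta> y * (R y - 2 * (v y * P y))) + 2 * (G y * \<epsilon> y)"
      unfolding W_grad_w_H by (simp add: algebra_simps)
  qed
  moreover have n: "(\<lambda>y. 2 * (\<delta> y * (R y - 2 * (v y * P y)))) \<in> H1_supp {..- 1}"
    by (intro H1_supp_cmult H1_supp_mult_neg[OF \<delta> R_2vP_supp]) auto
  moreover have p: "(\<lambda>y. 2 * (G y * \<epsilon> y)) \<in> H1_supp {1..}"
    by (intro H1_supp_cmult H1_supp_mult_pos[OF G_supp \<epsilon>]) auto
  ultimately have "fourier_coeff (\<lambda>y. grad_p_J m y * grad_w_J n y - grad_w_J m y * grad_p_J n y) 0 = 0"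
    by (simp add: fourier_coeff_H1_add H1_supp_H1[OF n] H1_supp_H1[OF p] mean_neg[OF n] mean_pos[OF p])
  then show ?thesis
    by (simp add: fourier_coeff_H1_diff H1_mult grad_w_J_H1 H1_supp_H1[OF grad_p_J_supp])
qed

text \<open>Writing \<open>u P = W P^2 - v P\<close> produces the error \<open>\<psi> v P\<close>,
  which has only negative frequencies and so mean zero. The other two means are finite sums by
  \<open>fourier_coeff_lowpass_mult\<close>, in which \<open>u\<close> and \<open>W P\<close> have
  the same positive coefficients.\<close>

lemma fourier_coeff_op_A_pairing:
  "fourier_coeff (\<lambda>y. (W y * \<alpha> m y - u y * \<psi> m y) * P y) 0
    = (\<Sum>i\<in>{1..<m}. fourier_coeff (\<lambda>y. W y * P y) i * fourier_coeff (\<lambda>y. W y * P y) (m - i))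
    - (\<Sum>i\<in>{1..<m}. fourier_coeff W i * fourier_coeff (\<lambda>y. W y * (P y)\<^sup>2) (m - i))"
proof -
  have N: "(\<lambda>y. W y * (P y)\<^sup>2) \<in> H1" by (intro H1_mult WH P2H)
  have a: "(\<lambda>y. \<psi> m y * (v y * P y)) \<in> H1_supp {..- 1}"
    by (rule H1_supp_mult_neg[OF \<psi>_supp(1)], rule H1_supp_mult_neg[OF v_supp P, where c = "- 1"]) auto
  have "fourier_coeff (\<lambda>y. (W y * \<alpha> m y - u y * \<psi> m y) * P y) 0
    = fourier_coeff (\<lambda>y. \<alpha> m y * (W y * P y) - \<psi> m y * (W y * (P y)\<^sup>2) + \<psi> m y * (v y * P y)) 0"
    by (simp add: v_def algebra_simps power2_eq_square)
  also have "\<dots> = fourier_coeff (\<lambda>y. \<alpha> m y * (W y * P y)) 0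
      - fourier_coeff (\<lambda>y. \<psi> m y * (W y * (P y)\<^sup>2)) 0"
    by (simp add: fourier_coeff_H1_add fourier_coeff_H1_diff H1_mult H1_diff \<alpha>\<psi>_H1 N WPH H1_supp_H1[OF a] mean_neg[OF a])
  also have "fourier_coeff (\<lambda>y. \<alpha> m y * (W y * P y)) 0
      = (\<Sum>i\<in>{1..<m}. fourier_coeff (\<lambda>y. W y * P y) i * fourier_coeff (\<lambda>y. W y * P y) (m - i))"
    unfolding \<alpha>_def fourier_coeff_lowpass_mult[OF u_supp WPH]
    by (rule sum.cong) (auto simp: u_def fourier_coeff_fproj[OF WPH])
  also have "fourier_coeff (\<lambda>y. \<psi> m y * (W y * (P y)\<^sup>2)) 0
      = (\<Sum>i\<in>{1..<m}. fourier_coeff W i * fourier_coeff (\<lambda>y. W y * (P y)\<^sup>2) (m - i))"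
    unfolding \<psi>_def by (rule fourier_coeff_lowpass_mult[OF W N])
  finally show ?thesis .
qed

text \<open>The variation \<open>2 W P B\<close> splits as \<open>2 u B + 2 v B\<close>, and
  \<open>v B\<close> has mean zero. Passing from \<open>W P\<close> to \<open>u\<close> leaves a
  gradient in \<open>p\<close> with positive frequencies only.\<close>

lemma differential_H:
  assumes B: "B \<in> H1_supp {..- 1}" and A: "A \<in> H1"
  shows "fourier_coeff (\<lambda>y. grad_w_H y * A y + 2 * W y * P y * B y) 0
    = fourier_coeff (\<lambda>y. grad_w_H y * A y) 0 + fourier_coeff (\<lambda>y. grad_p_H y * B y) 0"
proof -
  note BH = H1_supp_H1[OF B]
  have a: "(\<lambda>y. 2 * (v y * B y)) \<in> H1_supp {..- 1}"
    by (intro H1_supp_cmult H1_supp_mult_neg[OF v_supp B]) auto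
  have "fourier_coeff (\<lambda>y. grad_w_H y * A y + 2 * W y * P y * B y) 0
      = fourier_coeff (\<lambda>y. grad_w_H y * A y + grad_p_H y * B y + 2 * (v y * B y)) 0"
    by (simp add: v_def grad_p_H_def algebra_simps)
  also have "\<dots> = fourier_coeff (\<lambda>y. grad_w_H y * A y) 0 + fourier_coeff (\<lambda>y. grad_p_H y * B y) 0"
    by (simp add: fourier_coeff_H1_add H1_add H1_mult grad_w_H_H1 A BH H1_supp_H1[OF grad_p_H_supp]
        H1_supp_H1[OF a] mean_neg[OF a])
  finally show ?thesis .
qed

text \<open>The left side is the product rule for the finite-sum form of the integral, with
  \<open>N\<close> and \<open>M\<close> the variations of \<open>W P\<close> and \<open>kap\<close>
  in direction \<open>(A, B)\<close>. Turning each sum back into a mean shows the gradients tested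
  against \<open>A\<close> and \<open>B\<close>.\<close>

lemma differential_J:
  fixes m :: int
  assumes A: "A \<in> H1_supp {1..}" and B: "B \<in> H1_supp {..- 1}"
  defines "N \<equiv> \<lambda>y. A y * P y + W y * B y" and "M \<equiv> \<lambda>y. grad_w_H y * A y + 2 * W y * P y * B y"
  shows "(\<Sum>i\<in>{1..<m}. fourier_coeff (\<lambda>y. W y * P y) i * fourier_coeff N (m - i)
        + fourier_coeff N i * fourier_coeff (\<lambda>y. W y * P y) (m - i))
      - (\<Sum>i\<in>{1..<m}. fourier_coeff W i * fourier_coeff M (m - i) + fourier_coeff A i * fourier_coeff kap (m - i))
    = fourier_coeff (\<lambda>y. grad_w_J m y * A y) 0 + fourier_coeff (\<lambda>y. grad_p_J m y * B y) 0"
proof -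
  note AH = H1_supp_H1[OF A] and BH = H1_supp_H1[OF B]
  have N: "N \<in> H1" unfolding N_def by (intro H1_add H1_mult AH BH WH PH)
  have M: "M \<in> H1" unfolding M_def by (intro H1_add H1_mult AH BH grad_w_H_H1 H1_cmult WH PH)
  have 1: "(\<Sum>i\<in>{1..<m}. fourier_coeff (\<lambda>y. W y * P y) i * fourier_coeff N (m - i))
      = fourier_coeff (\<lambda>y. \<alpha> m y * N y) 0"
    unfolding \<alpha>_def fourier_coeff_lowpass_mult[OF u_supp N]
    by (rule sum.cong) (auto simp: u_def fourier_coeff_fproj[OF WPH])
  \<comment> \<open>The substitution of \<open>m - i\<close> for \<open>i\<close> preserves the
    range, so both halves of the product rule agree. This is the source of the factor 2 on \<alpha>
    in the gradients.\<close>
  have 2: "(\<Sum>i\<in>{1..<m}. fourier_coeff N i * fourier_coeff (\<lambda>y. W y * P y) (m - i))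
      = fourier_coeff (\<lambda>y. \<alpha> m y * N y) 0"
    unfolding 1[symmetric]
    by (rule sum.reindex_bij_witness[of _ "\<lambda>i. m - i" "\<lambda>i. m - i"]) auto
  have 3: "(\<Sum>i\<in>{1..<m}. fourier_coeff W i * fourier_coeff M (m - i)) = fourier_coeff (\<lambda>y. \<psi> m y * M y) 0"
    unfolding \<psi>_def by (rule fourier_coeff_lowpass_mult[OF W M, symmetric])
  have 4: "(\<Sum>i\<in>{1..<m}. fourier_coeff A i * fourier_coeff kap (m - i))
      = fourier_coeff (\<lambda>y. mode (- m) y * (A y * G y)) 0"
    unfolding fourier_coeff_mode_mult
    using fourier_coeff_mult_pos[OF A G_supp, of m] by (auto simp: G_def fourier_coeff_fproj[OF kapH])
  \<comment> \<open>This correction, from replacing \<open>W P\<close> by \<open>u\<close> in the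
    variation of \<open>p\<close>, has mean zero.\<close>
  have a: "(\<lambda>y. 2 * (\<psi> m y * (v y * B y))) \<in> H1_supp {..- 1}"
    by (intro H1_supp_cmult, rule H1_supp_mult_neg[OF \<psi>_supp(1)],
        rule H1_supp_mult_neg[OF v_supp B, where c = "- 1"]) auto
  have "(\<lambda>y. grad_w_J m y * A y + grad_p_J m y * B y)
      = (\<lambda>y. 2 * (\<alpha> m y * N y) - \<psi> m y * M y - mode (- m) y * (A y * G y) + 2 * (\<psi> m y * (v y * B y)))"
    by (simp add: fun_eq_iff grad_w_J_def grad_p_J_def N_def M_def v_def algebra_simps)
  then have "fourier_coeff (\<lambda>y. grad_w_J m y * A y + grad_p_J m y * B y) 0
      = 2 * fourier_coeff (\<lambda>y. \<alpha> m y * N y) 0 - fourier_coeff (\<lambda>y. \<psi> m y * M y) 0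
        - fourier_coeff (\<lambda>y. mode (- m) y * (A y * G y)) 0"
    by (simp add: fourier_coeff_H1_add fourier_coeff_H1_diff fourier_coeff_cmult H1_diff H1_cmult H1_mult \<alpha>\<psi>_H1 N M H1_mode AH
        base_H1 H1_supp_H1[OF a, simplified] mean_neg[OF a, unfolded fourier_coeff_cmult])
  moreover have "fourier_coeff (\<lambda>y. grad_w_J m y * A y + grad_p_J m y * B y) 0
      = fourier_coeff (\<lambda>y. grad_w_J m y * A y) 0 + fourier_coeff (\<lambda>y. grad_p_J m y * B y) 0"
    by (intro fourier_coeff_H1_add H1_mult grad_w_J_H1 H1_supp_H1[OF grad_p_J_supp] AH BH)
  ultimately show ?thesis by (simp add: sum.distrib 1 2 3 4)
qed

end

section \<open>Point evaluation\<close>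

text \<open>Cauchy-Schwarz on finite sets of frequencies, after splitting \<open>b k\<close> as
  \<open>weight k\<close> times \<open>b k / weight k\<close>.\<close>

lemma H1_weighted_sum_le:
  assumes f: "f \<in> H1" and b: "\<And>k. b k \<ge> 0" and S: "(\<lambda>k. (b k / weight k)\<^sup>2) summable_on UNIV"
  shows "(\<lambda>k. cmod (fourier_coeff f k) * b k) summable_on UNIV"
    and "(\<Sum>\<^sub>\<infinity>k. cmod (fourier_coeff f k) * b k) \<le> H1_norm f * sqrt (\<Sum>\<^sub>\<infinity>k. (b k / weight k)\<^sup>2)"
proof -
  have F: "(\<Sum>k\<in>F. cmod (fourier_coeff f k) * b k) \<le> H1_norm f * sqrt (\<Sum>\<^sub>\<infinity>k. (b k / weight k)\<^sup>2)"
    if "finite F" for F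
  proof -
    have w: "weight k > 0" for k using weight_ge_1[of k] by linarith
    then have "(\<Sum>k\<in>F. cmod (fourier_coeff f k) * b k)
        = (\<Sum>k\<in>F. \<bar>cmod (fourier_coeff f k) * weight k\<bar> * \<bar>b k / weight k\<bar>)"
      using b by (intro sum.cong) (simp_all add: abs_mult less_imp_neq[symmetric] less_imp_le)
    also have "\<dots> \<le> L2_set (\<lambda>k. cmod (fourier_coeff f k) * weight k) F * L2_set (\<lambda>k. b k / weight k) F"
      by (rule L2_set_mult_ineq)
    also have "\<dots> \<le> H1_norm f * sqrt (\<Sum>\<^sub>\<infinity>k. (b k / weight k)\<^sup>2)"
    proof (rule mult_mono)
      show "L2_set (\<lambda>k. b k / weight k) F \<le> sqrt (\<Sum>\<^sub>\<infinity>k. (b k / weight k)\<^sup>2)"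
        unfolding L2_set_def by (intro real_sqrt_le_mono finite_sum_le_infsum S that) auto
    qed (auto intro!: H1_norm_partial f that H1_norm_nonneg L2_set_nonneg)
    finally show ?thesis .
  qed
  show s: "(\<lambda>k. cmod (fourier_coeff f k) * b k) summable_on UNIV"
    by (rule nonneg_bdd_above_summable_on) (use b F in \<open>auto intro!: bdd_aboveI2\<close>)
  show "(\<Sum>\<^sub>\<infinity>k. cmod (fourier_coeff f k) * b k) \<le> H1_norm f * sqrt (\<Sum>\<^sub>\<infinity>k. (b k / weight k)\<^sup>2)"
    by (rule infsum_le_finite_sums[OF s F])
qed

text \<open>By Cauchy-Schwarz this bounds the functional sending \<open>f\<close> to
  \<open>f (y + h) - f y\<close>, uniformly in \<open>y\<close>.\<close>

definition modulus :: "real \<Rightarrow> real" where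
  "modulus h = sqrt (\<Sum>\<^sub>\<infinity>k. (cmod (mode k h - 1) / weight k)\<^sup>2)"

lemma modulus_majorant:
  "norm ((cmod (mode k h - 1) / weight k)\<^sup>2) \<le> 4 * (1 / (weight k)\<^sup>2)"
proof -
  have "cmod (mode k h - 1) \<le> 2" by (simp add: norm_mode_minus_1)
  then have "(cmod (mode k h - 1))\<^sup>2 \<le> 2\<^sup>2" by (intro power_mono) auto
  then show ?thesis by (simp add: power_divide divide_right_mono)
qed

lemma modulus_summable: "(\<lambda>k. (cmod (mode k h - 1) / weight k)\<^sup>2) summable_on UNIV"
  by (rule summable_on_comparison_test[OF summable_on_cmult_right[OF summable_inverse_weight, of 4]])
    (use modulus_majorant in auto)

text \<open>The terms have a summable majorant independent of \<open>h\<close>, so the series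
  converges uniformly.\<close>

lemma continuous_modulus: "continuous_on UNIV modulus"
proof -
  have lim: "uniform_limit UNIV (\<lambda>X h. \<Sum>k\<in>X. (cmod (mode k h - 1) / weight k)\<^sup>2)
      (\<lambda>h. \<Sum>\<^sub>\<infinity>k. (cmod (mode k h - 1) / weight k)\<^sup>2) (finite_subsets_at_top UNIV)"
    by (rule Weierstrass_m_test_general[OF modulus_majorant summable_on_cmult_right[OF summable_inverse_weight]])
  have "weight k \<noteq> 0" for k using weight_ge_1[of k] by linarith
  then have "continuous_on UNIV (\<lambda>h. \<Sum>\<^sub>\<infinity>k. (cmod (mode k h - 1) / weight k)\<^sup>2)"
    by (intro uniform_limit_theorem[OF _ lim]) (auto intro!: always_eventually continuous_intros)
  then show ?thesis unfolding modulus_def[abs_def] by (rule continuous_on_real_sqrt)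
qed

lemma H1_modulus_of_continuity:
  assumes f: "f \<in> H1"
  shows "cmod (f (y + h) - f y) \<le> modulus h * H1_norm f"
proof -
  have "((\<lambda>k. fourier_coeff f k * mode k (y + h) - fourier_coeff f k * mode k y) has_sum f (y + h) - f y) UNIV"
    using has_sum_add[OF has_sum_fourier[OF f, of "y + h"]
        has_sum_cmult_right[OF has_sum_fourier[OF f, of y], of "- 1"]] by simp
  then have hs: "((\<lambda>k. fourier_coeff f k * mode k y * (mode k h - 1)) has_sum f (y + h) - f y) UNIV"
    by (rule has_sum_cong[THEN iffD1, rotated]) (simp add: mode_add algebra_simps)
  note s = H1_weighted_sum_le[OF f, of "\<lambda>k. cmod (mode k h - 1)", OF norm_ge_zero modulus_summable]
  have "cmod (f (y + h) - f y) \<le> (\<Sum>\<^sub>\<infinity>k. cmod (fourier_coeff f k) * cmod (mode k h - 1))"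
    unfolding infsumI[OF hs, symmetric]
    by (rule order_trans[OF norm_infsum_bound]) (use s(1) in \<open>simp_all add: norm_mult\<close>)
  also have "\<dots> \<le> H1_norm f * modulus h"
    using s(2) by (simp add: modulus_def)
  finally show ?thesis by (simp add: mult.commute)
qed

lemma H1_sup_bound: "\<exists>C. \<forall>f\<in>H1. \<forall>y. cmod (f y) \<le> H1_norm f * C"
proof (intro exI ballI allI)
  fix f :: "real \<Rightarrow> complex" and y assume f: "f \<in> H1"
  have S: "(\<lambda>k. (1 / weight k)\<^sup>2) summable_on UNIV"
    using summable_inverse_weight by (simp only: power_divide power_one)
  note s = H1_weighted_sum_le[OF f, of "\<lambda>_. 1", OF zero_le_one S]
  have "cmod (\<Sum>\<^sub>\<infinity>k. fourier_coeff f k * mode k y) \<le> (\<Sum>\<^sub>\<infinity>k. cmod (fourier_coeff f k * mode k y))"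
    by (rule norm_infsum_bound) (simp add: norm_mult H1_norm_coeff_summable[OF f])
  then have "cmod (f y) \<le> (\<Sum>\<^sub>\<infinity>k. cmod (fourier_coeff f k))"
    by (simp add: infsumI[OF has_sum_fourier[OF f, of y]] norm_mult)
  also have "\<dots> \<le> H1_norm f * sqrt (\<Sum>\<^sub>\<infinity>k. (1 / weight k)\<^sup>2)"
    using s(2) by (simp only: mult_1_right)
  finally show "cmod (f y) \<le> H1_norm f * sqrt (\<Sum>\<^sub>\<infinity>k. (1 / weight k)\<^sup>2)" .
qed

text \<open>Evaluation is packaged as a bounded functional so that its continuity in
  \<open>y\<close> can be stated in the operator norm, in which differentials have to be
  continuous.\<close>

definition point_eval :: "real \<Rightarrow> H1p0 \<Rightarrow>\<^sub>L complex" where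
  "point_eval y = Blinfun (\<lambda>w. fn w y)"

lemma point_eval [simp]: "point_eval y w = fn w y"
proof -
  obtain C where C: "\<And>f y. f \<in> H1 \<Longrightarrow> cmod (f y) \<le> H1_norm f * C"
    using H1_sup_bound by blast
  have "bounded_linear (\<lambda>w. fn w y)"
    by (rule bounded_linear_intro[of _ C])
      (use C[OF fn_H1] in \<open>simp_all add: plus_H1p0.rep_eq scaleR_H1p0.rep_eq norm_H1p0_def scaleR_conv_of_real\<close>)
  then show ?thesis by (simp add: point_eval_def bounded_linear_Blinfun_apply)
qed

text \<open>The operator norm of a difference of evaluations is at most
  \<open>modulus (z - y)\<close>, which tends to \<open>modulus 0 = 0\<close>.\<close>

lemma continuous_point_eval: "continuous_on UNIV point_eval"
proof -
  have m0: "modulus 0 = 0" by (simp add: modulus_def mode_def)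
  have mn: "modulus h \<ge> 0" for h
    unfolding modulus_def by (intro real_sqrt_ge_zero infsum_nonneg) auto
  have bound: "norm (point_eval z - point_eval y) \<le> modulus (z - y)" for y z
  proof (rule norm_blinfun_bound[OF mn])
    fix w :: H1p0
    show "norm ((point_eval z - point_eval y) w) \<le> modulus (z - y) * norm w"
      using H1_modulus_of_continuity[OF fn_H1, of w y "z - y"]
      by (simp add: blinfun.diff_left norm_H1p0_def)
  qed
  have "isCont point_eval y" for y
  proof -
    have c: "continuous_on UNIV (\<lambda>z. modulus (z - y))"
      by (rule continuous_on_compose2[OF continuous_modulus]) (auto intro!: continuous_intros)
    then have "isCont (\<lambda>z. modulus (z - y)) y" by (simp add: continuous_on_eq_continuous_at)
    then have "(\<lambda>z. modulus (z - y)) \<midarrow>y\<rightarrow> 0" unfolding isCont_def by (simp add: m0)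
    then have "(\<lambda>z. point_eval z - point_eval y) \<midarrow>y\<rightarrow> 0"
      by (rule Lim_null_comparison[rotated]) (simp add: bound)
    then show ?thesis unfolding isCont_def by (simp add: LIM_zero_iff)
  qed
  then show ?thesis by (simp add: continuous_on_eq_continuous_at)
qed

lemma continuous_on_fn [continuous_intros]:
  assumes "continuous_on A g" "continuous_on A h"
  shows "continuous_on A (\<lambda>x. fn (g x) (h x))"
proof -
  have "continuous_on A (\<lambda>x. point_eval (h x) (g x))"
    by (intro blinfun.continuous_on assms continuous_on_compose2[OF continuous_point_eval assms(2)]) auto
  then show ?thesis by simp
qed

lemma open_phase_space: "open phase_space"
proof -
  obtain C where C: "\<And>f y. f \<in> H1 \<Longrightarrow> cmod (f y) \<le> H1_norm f * C"
    using H1_sup_bound by blast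
  have "open nonvanishing"
    unfolding open_dist
  proof
    fix w assume "w \<in> nonvanishing"
    then obtain c where c: "c > 0" "\<And>y. c \<le> cmod (fn w y)"
      using H1_nonzero_lower_bound[OF fn_H1, of w] by (auto simp: nonvanishing_def)
    \<comment> \<open>By the sup bound such a perturbation changes values by less than the lower
      bound \<open>c\<close> of \<open>|fn w|\<close>. The denominator
      \<open>\<bar>C\<bar> + 1\<close> keeps the radius positive whatever the sign of
      \<open>C\<close>.\<close>
    have "w' \<in> nonvanishing" if "dist w' w < c / (\<bar>C\<bar> + 1)" for w'
    proof -
      have "fn w' y \<noteq> 0" for y
      proof
        assume "fn w' y = 0"
        then have "c \<le> cmod (fn (w' - w) y)" using c(2)[of y] by (simp add: minus_H1p0.rep_eq)
        also have "\<dots> \<le> norm (w' - w) * C" using C[OF fn_H1] by (simp add: norm_H1p0_def)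
        also have "\<dots> \<le> norm (w' - w) * (\<bar>C\<bar> + 1)" by (intro mult_left_mono) auto
        also have "\<dots> < c" using that by (simp add: dist_norm pos_less_divide_eq)
        finally show False by simp
      qed
      then show ?thesis by (simp add: nonvanishing_def)
    qed
    then show "\<exists>e>0. \<forall>w'. dist w' w < e \<longrightarrow> w' \<in> nonvanishing"
      using c(1) by (intro exI[of _ "c / (\<bar>C\<bar> + 1)"]) auto
  qed
  then show ?thesis unfolding phase_space_def by (intro open_Times) auto
qed

section \<open>Analytic functionals\<close>

lemma banach_analytic_cong:
  assumes "banach_analytic F U" "\<And>x. x \<in> U \<Longrightarrow> F x = G x"
  shows "banach_analytic G U"
proof -
  have U: "open U" using assms(1) by (simp add: banach_analytic_def)
  have "(G has_derivative D) (at x)" if "(F has_derivative D) (at x)" "x \<in> U" for D x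
    using has_derivative_transform_within_open[OF that(1) U that(2) assms(2)] .
  then show ?thesis using assms(1) unfolding banach_analytic_def by blast
qed

lemma scaleC_zero_right [simp]: "c *\<^sub>C (0 :: 'a::complex_banach) = 0"
  using norm_scaleC[of c "0 :: 'a"] by simp

lemma banach_analytic_const: "open U \<Longrightarrow> banach_analytic (\<lambda>x. c) U"
  unfolding banach_analytic_def
  by (intro conjI exI[of _ "\<lambda>x. 0"]) (auto simp: zero_blinfun.rep_eq)

lemma banach_analytic_add:
  assumes "banach_analytic F U" "banach_analytic G U"
  shows "banach_analytic (\<lambda>x. F x + G x) U"
proof -
  obtain D E where D: "continuous_on U D" "\<And>x. x \<in> U \<Longrightarrow> (F has_derivative blinfun_apply (D x)) (at x)"
      "\<And>x c h. x \<in> U \<Longrightarrow> D x (c *\<^sub>C h) = c *\<^sub>C D x h"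
    and E: "continuous_on U E" "\<And>x. x \<in> U \<Longrightarrow> (G has_derivative blinfun_apply (E x)) (at x)"
      "\<And>x c h. x \<in> U \<Longrightarrow> E x (c *\<^sub>C h) = c *\<^sub>C E x h"
    using assms unfolding banach_analytic_def by metis
  show ?thesis unfolding banach_analytic_def
  proof (intro conjI exI[of _ "\<lambda>x. D x + E x"] ballI allI)
    show "((\<lambda>x. F x + G x) has_derivative blinfun_apply (D x + E x)) (at x)" if "x \<in> U" for x
      using has_derivative_add[OF D(2) E(2), OF that that] by (simp add: plus_blinfun.rep_eq)
  qed (use assms(1) D E in \<open>auto simp: banach_analytic_def plus_blinfun.rep_eq scaleC_add_right intro!: continuous_intros\<close>)
qed

lemma banach_analytic_mult:
  fixes F G :: "'a::complex_banach \<Rightarrow> complex"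
  assumes "banach_analytic F U" "banach_analytic G U"
  shows "banach_analytic (\<lambda>x. F x * G x) U"
proof -
  obtain D E where D: "continuous_on U D" "\<And>x. x \<in> U \<Longrightarrow> (F has_derivative blinfun_apply (D x)) (at x)"
      "\<And>x c h. x \<in> U \<Longrightarrow> D x (c *\<^sub>C h) = c *\<^sub>C D x h"
    and E: "continuous_on U E" "\<And>x. x \<in> U \<Longrightarrow> (G has_derivative blinfun_apply (E x)) (at x)"
      "\<And>x c h. x \<in> U \<Longrightarrow> E x (c *\<^sub>C h) = c *\<^sub>C E x h"
    using assms unfolding banach_analytic_def by metis
  have U: "open U" using assms(1) by (simp add: banach_analytic_def)
  have cF: "continuous_on U F" and cG: "continuous_on U G"
    using D(2) E(2) by (auto simp: continuous_on_eq_continuous_at[OF U] intro: has_derivative_continuous)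
  let ?D = "\<lambda>x. (blinfun_mult_right (F x) o\<^sub>L E x) + (blinfun_mult_right (G x) o\<^sub>L D x)"
  show ?thesis unfolding banach_analytic_def
  proof (intro conjI exI[of _ ?D] ballI allI)
    show "((\<lambda>x. F x * G x) has_derivative blinfun_apply (?D x)) (at x)" if "x \<in> U" for x
      using has_derivative_mult[OF D(2) E(2), OF that that] by (simp add: plus_blinfun.rep_eq mult.commute)
    show "continuous_on U ?D"
      by (intro continuous_intros D E cF cG bounded_linear.continuous_on[OF bounded_linear_blinfun_mult_right]
          bounded_bilinear.continuous_on[OF bounded_bilinear_blinfun_compose])
  qed (use U D E in \<open>auto simp: plus_blinfun.rep_eq scaleC_complex_def algebra_simps\<close>)
qed

lemma banach_analytic_diff:
  fixes F G :: "'a::complex_banach \<Rightarrow> complex"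
  assumes "banach_analytic F U" "banach_analytic G U"
  shows "banach_analytic (\<lambda>x. F x - G x) U"
proof -
  have "open U" using assms(1) by (simp add: banach_analytic_def)
  then have "banach_analytic (\<lambda>x. F x + (- 1) * G x) U"
    by (intro banach_analytic_add banach_analytic_mult banach_analytic_const assms)
  then show ?thesis by simp
qed

lemma banach_analytic_sum:
  assumes "finite A" "open U" "\<And>i. i \<in> A \<Longrightarrow> banach_analytic (F i) U"
  shows "banach_analytic (\<lambda>x. \<Sum>i\<in>A. F i x) U"
  using assms(1,3) by (induction A) (auto intro: banach_analytic_add banach_analytic_const assms(2))

lemma fn_scaleC: "fn (c *\<^sub>C w) y = c * fn w y"
  by (simp add: scaleC_H1p0.rep_eq)

section \<open>Differentiation under the integral sign\<close>

context
  fixes K Ka Kb :: "real \<Rightarrow> complex \<Rightarrow> complex \<Rightarrow> complex"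
  assumes cont: "continuous_on (UNIV \<times> (- {0}) \<times> UNIV) (\<lambda>(t, a, b). K t a b)"
      "continuous_on (UNIV \<times> (- {0}) \<times> UNIV) (\<lambda>(t, a, b). Ka t a b)"
      "continuous_on (UNIV \<times> (- {0}) \<times> UNIV) (\<lambda>(t, a, b). Kb t a b)"
    and deriv: "\<And>t a b. a \<noteq> 0 \<Longrightarrow>
      ((\<lambda>z. K t (fst z) (snd z)) has_derivative (\<lambda>z. Ka t a b * fst z + Kb t a b * snd z)) (at (a, b))"
begin

lemma continuous_on_superposition:
  assumes k: "continuous_on (UNIV \<times> (- {0}) \<times> UNIV) (\<lambda>(t, a, b). k t a b)"
  shows "continuous_on (phase_space \<times> A) (\<lambda>(x, t). k t (fn (fst x) t) (fn (snd x) (- t)) :: complex)"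
proof -
  have "continuous_on (phase_space \<times> A) (\<lambda>z. (snd z, fn (fst (fst z)) (snd z), fn (snd (fst z)) (- snd z)))"
    by (intro continuous_intros)
  then have "continuous_on (phase_space \<times> A)
      (\<lambda>z. (\<lambda>(t, a, b). k t a b) (snd z, fn (fst (fst z)) (snd z), fn (snd (fst z)) (- snd z)))"
    by (rule continuous_on_compose2[OF k]) (auto simp: phase_space_def nonvanishing_def)
  then show ?thesis by (simp add: case_prod_beta')
qed

text \<open>The kernel sees \<open>w\<close> at \<open>t\<close> and \<open>p\<close> at
  \<open>- t\<close>, that is, the pair \<open>(W, P)\<close>. Each coefficient functional arises
  from one choice of \<open>K\<close>, with partial derivatives \<open>Ka\<close> and
  \<open>Kb\<close>.\<close>

definition superposition :: "H1p0 \<times> H1p0 \<Rightarrow> complex" where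
  "superposition x = integral {0..1} (\<lambda>t. K t (fn (fst x) t) (fn (snd x) (- t)))"

definition integrand_deriv :: "H1p0 \<times> H1p0 \<Rightarrow> real \<Rightarrow> (H1p0 \<times> H1p0) \<Rightarrow>\<^sub>L complex" where
  "integrand_deriv x t =
    (blinfun_mult_right (Ka t (fn (fst x) t) (fn (snd x) (- t))) o\<^sub>L (point_eval t o\<^sub>L fst_blinfun)) +
    (blinfun_mult_right (Kb t (fn (fst x) t) (fn (snd x) (- t))) o\<^sub>L (point_eval (- t) o\<^sub>L snd_blinfun))"

lemma integrand_deriv_apply:
  "integrand_deriv x t h = Ka t (fn (fst x) t) (fn (snd x) (- t)) * fn (fst h) t
    + Kb t (fn (fst x) t) (fn (snd x) (- t)) * fn (snd h) (- t)"
  by (simp add: integrand_deriv_def plus_blinfun.rep_eq)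

text \<open>Joint continuity holds in the operator norm because \<open>point_eval\<close> is
  norm-continuous and the scalar factors are jointly continuous where \<open>w\<close> has no
  zeros.\<close>

lemma continuous_integrand_deriv:
  "continuous_on (phase_space \<times> A) (\<lambda>(x, t). integrand_deriv x t)"
proof -
  have pe: "continuous_on (phase_space \<times> A) (\<lambda>z. point_eval (snd z))"
      "continuous_on (phase_space \<times> A) (\<lambda>z. point_eval (- snd z))"
    by (rule continuous_on_compose2[OF continuous_point_eval]; simp add: continuous_on_snd continuous_on_minus)+
  have prod: "continuous_on (phase_space \<times> A)
      (\<lambda>z. blinfun_mult_right (k (snd z) (fn (fst (fst z)) (snd z)) (fn (snd (fst z)) (- snd z))) o\<^sub>L (e z o\<^sub>L l))"
    if k: "continuous_on (UNIV \<times> (- {0}) \<times> UNIV) (\<lambda>(t, a, b). k t a b)"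
      and e: "continuous_on (phase_space \<times> A) e"
    for k and e :: "_ \<Rightarrow> H1p0 \<Rightarrow>\<^sub>L complex" and l :: "(H1p0 \<times> H1p0) \<Rightarrow>\<^sub>L H1p0"
  proof (rule bounded_bilinear.continuous_on[OF bounded_bilinear_blinfun_compose])
    show "continuous_on (phase_space \<times> A)
        (\<lambda>z. blinfun_mult_right (k (snd z) (fn (fst (fst z)) (snd z)) (fn (snd (fst z)) (- snd z))))"
      using bounded_linear.continuous_on[OF bounded_linear_blinfun_mult_right continuous_on_superposition[OF k]]
      by (simp add: case_prod_beta')
    show "continuous_on (phase_space \<times> A) (\<lambda>z. e z o\<^sub>L l)"
      by (rule bounded_bilinear.continuous_on[OF bounded_bilinear_blinfun_compose e continuous_on_const])
  qed
  show ?thesis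
    unfolding integrand_deriv_def case_prod_beta'
    by (rule continuous_on_add[OF prod[OF cont(2) pe(1)] prod[OF cont(3) pe(2)]])
qed

lemma integrand_deriv_integrable:
  assumes "x \<in> phase_space"
  shows "integrand_deriv x integrable_on {0..1}"
proof -
  have "continuous_on {0..1} (\<lambda>t. (\<lambda>(x, t). integrand_deriv x t) (x, t))"
    by (rule continuous_on_compose2[OF continuous_integrand_deriv[of UNIV]])
      (use assms in \<open>auto intro!: continuous_intros\<close>)
  then show ?thesis by (intro integrable_continuous_real) simp
qed

lemma superposition_has_blinfun_derivative:
  assumes x: "x \<in> phase_space"
  shows "(superposition has_derivative blinfun_apply (integral {0..1} (integrand_deriv x))) (at x)"
proof -
  \<comment> \<open>The Leibniz rule asks for a convex domain, which a ball inside the open phase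
    space supplies.\<close>
  obtain e where e: "e > 0" "ball x e \<subseteq> phase_space"
    using open_phase_space x by (auto simp: open_contains_ball)
  have "((\<lambda>x. integral (cbox 0 1) (\<lambda>t. K t (fn (fst x) t) (fn (snd x) (- t)))) has_derivative
      blinfun_apply (integral (cbox 0 1) (integrand_deriv x))) (at x within ball x e)"
  proof (rule leibniz_rule[where U = "ball x e" and fx = integrand_deriv])
    fix x' t assume x': "x' \<in> ball x e"
    then have nz: "fn (fst x') t \<noteq> 0" for t using e by (auto simp: phase_space_def nonvanishing_def)
    have "((\<lambda>x. (point_eval t (fst x), point_eval (- t) (snd x))) has_derivative
        (\<lambda>h. (point_eval t (fst h), point_eval (- t) (snd h)))) (at x')"
      by (intro bounded_linear_imp_has_derivative bounded_linear_Pair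
          bounded_linear_compose[OF blinfun.bounded_linear_right] bounded_linear_fst bounded_linear_snd)
    from has_derivative_compose[OF this[simplified] deriv[OF nz]]
    have "((\<lambda>x. K t (fn (fst x) t) (fn (snd x) (- t))) has_derivative blinfun_apply (integrand_deriv x' t)) (at x')"
      by (simp add: integrand_deriv_apply[abs_def])
    then show "((\<lambda>x. K t (fn (fst x) t) (fn (snd x) (- t))) has_derivative blinfun_apply (integrand_deriv x' t))
        (at x' within ball x e)"
      by (rule has_derivative_at_withinI)
  next
    fix x' assume x': "x' \<in> ball x e"
    have "continuous_on {0..1} (\<lambda>t. (\<lambda>(x, t). K t (fn (fst x) t) (fn (snd x) (- t))) (x', t))"
      by (rule continuous_on_compose2[OF continuous_on_superposition[OF cont(1), of UNIV]])
        (use x' e in \<open>auto intro!: continuous_intros\<close>)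
    then show "(\<lambda>t. K t (fn (fst x') t) (fn (snd x') (- t))) integrable_on cbox 0 1"
      by (simp add: integrable_continuous_real)
  next
    show "continuous_on (ball x e \<times> cbox 0 1) (\<lambda>(x, t). integrand_deriv x t)"
      by (rule continuous_on_subset[OF continuous_integrand_deriv[of UNIV]]) (use e in auto)
  qed (use e in auto)
  then show ?thesis
    using e(1) by (simp add: superposition_def[abs_def] at_within_open[of x "ball x e"])
qed

lemma superposition_has_derivative:
  assumes x: "x \<in> phase_space"
  shows "(superposition has_derivative (\<lambda>h. integral {0..1}
      (\<lambda>t. Ka t (fn (fst x) t) (fn (snd x) (- t)) * fn (fst h) t
        + Kb t (fn (fst x) t) (fn (snd x) (- t)) * fn (snd h) (- t)))) (at x)"
proof -
  have "blinfun_apply (integral {0..1} (integrand_deriv x)) = (\<lambda>h. integral {0..1}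
      (\<lambda>t. Ka t (fn (fst x) t) (fn (snd x) (- t)) * fn (fst h) t
        + Kb t (fn (fst x) t) (fn (snd x) (- t)) * fn (snd h) (- t)))"
    by (rule ext) (simp only: blinfun_apply_integral[OF integrand_deriv_integrable[OF x]] integrand_deriv_apply)
  then show ?thesis using superposition_has_blinfun_derivative[OF x] by (simp only:)
qed

text \<open>The differential is a parameter integral of a jointly continuous integrand, hence
  continuous. It is complex-linear because it multiplies point evaluations by complex
  numbers.\<close>

lemma superposition_analytic: "banach_analytic superposition phase_space"
  unfolding banach_analytic_def
proof (intro conjI exI[of _ "\<lambda>x. integral {0..1} (integrand_deriv x)"] ballI allI)
  show "continuous_on phase_space (\<lambda>x. integral {0..1} (integrand_deriv x))"
    using integral_continuous_on_param[OF continuous_integrand_deriv[of "cbox 0 1"]] by simp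
  fix x c and h :: "H1p0 \<times> H1p0" assume x: "x \<in> phase_space"
  show "blinfun_apply (integral {0..1} (integrand_deriv x)) (c *\<^sub>C h)
      = c *\<^sub>C blinfun_apply (integral {0..1} (integrand_deriv x)) h"
    unfolding blinfun_apply_integral[OF integrand_deriv_integrable[OF x]] scaleC_complex_def
      integral_mult_right[symmetric]
    by (rule arg_cong[where f = "integral {0..1}"])
      (simp add: fun_eq_iff integrand_deriv_apply scaleC_prod_def fn_scaleC algebra_simps)
qed (simp_all add: open_phase_space superposition_has_blinfun_derivative)

end

lemma
  fixes K Ka Kb :: "real \<Rightarrow> complex \<Rightarrow> complex \<Rightarrow> complex"
  assumes cont: "continuous_on (UNIV \<times> (- {0}) \<times> UNIV) (\<lambda>(t, a, b). K t a b)"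
      "continuous_on (UNIV \<times> (- {0}) \<times> UNIV) (\<lambda>(t, a, b). Ka t a b)"
      "continuous_on (UNIV \<times> (- {0}) \<times> UNIV) (\<lambda>(t, a, b). Kb t a b)"
    and deriv: "\<And>t a b. a \<noteq> 0 \<Longrightarrow>
      ((\<lambda>z. K t (fst z) (snd z)) has_derivative (\<lambda>z. Ka t a b * fst z + Kb t a b * snd z)) (at (a, b))"
  shows coeff_functional_analytic:
      "banach_analytic (\<lambda>x. fourier_coeff (\<lambda>t. K t (fn (fst x) t) (fn (snd x) (- t))) n) phase_space"
    and coeff_functional_has_derivative: "x \<in> phase_space \<Longrightarrow>
      ((\<lambda>x. fourier_coeff (\<lambda>t. K t (fn (fst x) t) (fn (snd x) (- t))) n) has_derivative
       (\<lambda>h. fourier_coeff (\<lambda>t. Ka t (fn (fst x) t) (fn (snd x) (- t)) * fn (fst h) t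
          + Kb t (fn (fst x) t) (fn (snd x) (- t)) * fn (snd h) (- t)) n)) (at x)"
proof -
  \<comment> \<open>Absorbing \<open>mode (- n)\<close> into the kernel makes every Fourier
    coefficient a superposition.\<close>
  let ?L = "\<lambda>K t a b. K t a b * mode (- n) t :: complex"
  have c: "continuous_on (UNIV \<times> (- {0}) \<times> UNIV) (\<lambda>(t, a, b). ?L k t a b)"
    if "continuous_on (UNIV \<times> (- {0}) \<times> UNIV) (\<lambda>(t, a, b). k t a b)" for k
    using continuous_on_mult[OF that continuous_on_mode[OF continuous_on_fst[OF continuous_on_id]]]
    by (simp add: case_prod_beta')
  have d: "((\<lambda>z. ?L K t (fst z) (snd z)) has_derivative (\<lambda>z. ?L Ka t a b * fst z + ?L Kb t a b * snd z)) (at (a, b))"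
    if "a \<noteq> 0" for t a b
    using has_derivative_mult_left[OF deriv[OF that, of t b], of "mode (- n) t"]
    by (simp add: algebra_simps)
  note s = superposition_analytic[of "?L K" "?L Ka" "?L Kb", OF c[OF cont(1)] c[OF cont(2)] c[OF cont(3)] d]
    superposition_has_derivative[of "?L K" "?L Ka" "?L Kb", OF c[OF cont(1)] c[OF cont(2)] c[OF cont(3)] d]
  have e: "superposition (?L K) = (\<lambda>x. fourier_coeff (\<lambda>t. K t (fn (fst x) t) (fn (snd x) (- t))) n)"
    by (simp add: fun_eq_iff superposition_def[OF c[OF cont(1)] c[OF cont(2)] c[OF cont(3)] d] fourier_coeff_conv_mode)
  show "banach_analytic (\<lambda>x. fourier_coeff (\<lambda>t. K t (fn (fst x) t) (fn (snd x) (- t))) n) phase_space"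
    using s(1) unfolding e .
  show "((\<lambda>x. fourier_coeff (\<lambda>t. K t (fn (fst x) t) (fn (snd x) (- t))) n) has_derivative
       (\<lambda>h. fourier_coeff (\<lambda>t. Ka t (fn (fst x) t) (fn (snd x) (- t)) * fn (fst h) t
          + Kb t (fn (fst x) t) (fn (snd x) (- t)) * fn (snd h) (- t)) n)) (at x)" if "x \<in> phase_space"
    using s(2)[OF _ that] unfolding e fourier_coeff_conv_mode by (simp add: algebra_simps)
qed

section \<open>The coefficients of \<open>w\<close>, \<open>wP\<close> and \<kappa> as analytic
  functionals\<close>

lemma
  shows coeff_w_analytic: "banach_analytic (\<lambda>x. fourier_coeff (fn (fst x)) n) phase_space"
    and coeff_w_has_derivative: "x \<in> phase_space \<Longrightarrow>
      ((\<lambda>x. fourier_coeff (fn (fst x)) n) has_derivative (\<lambda>h. fourier_coeff (fn (fst h)) n)) (at x)"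
proof -
  have c: "continuous_on A (\<lambda>(t :: real, a :: complex, b :: complex). a)"
      "continuous_on A (\<lambda>(t :: real, a :: complex, b :: complex). 1 :: complex)"
      "continuous_on A (\<lambda>(t :: real, a :: complex, b :: complex). 0 :: complex)" for A
    by (auto simp: case_prod_beta' intro!: continuous_intros)
  have d: "((\<lambda>z. fst z) has_derivative (\<lambda>z. 1 * fst z + 0 * snd z)) (at (a, b))" for a b :: complex
    by (auto intro!: derivative_eq_intros)
  note * = coeff_functional_analytic[OF c d, of n] coeff_functional_has_derivative[OF c d, of x n]
  show "banach_analytic (\<lambda>x. fourier_coeff (fn (fst x)) n) phase_space"
    using *(1) by simp
  show "((\<lambda>x. fourier_coeff (fn (fst x)) n) has_derivative (\<lambda>h. fourier_coeff (fn (fst h)) n)) (at x)"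
    if "x \<in> phase_space"
    using *(2)[OF that] by simp
qed

lemma
  shows coeff_wp_analytic:
      "banach_analytic (\<lambda>x. fourier_coeff (\<lambda>t. fn (fst x) t * fn (snd x) (- t)) n) phase_space"
    and coeff_wp_has_derivative: "x \<in> phase_space \<Longrightarrow>
      ((\<lambda>x. fourier_coeff (\<lambda>t. fn (fst x) t * fn (snd x) (- t)) n) has_derivative
       (\<lambda>h. fourier_coeff (\<lambda>t. fn (fst h) t * fn (snd x) (- t) + fn (fst x) t * fn (snd h) (- t)) n)) (at x)"
proof -
  have c: "continuous_on A (\<lambda>(t :: real, a :: complex, b :: complex). a * b)"
      "continuous_on A (\<lambda>(t :: real, a :: complex, b :: complex). b)"
      "continuous_on A (\<lambda>(t :: real, a :: complex, b :: complex). a)" for A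
    by (auto simp: case_prod_beta' intro!: continuous_intros)
  have d: "((\<lambda>z. fst z * snd z) has_derivative (\<lambda>z. b * fst z + a * snd z)) (at (a, b))" for a b :: complex
    by (auto intro!: derivative_eq_intros simp: algebra_simps)
  note * = coeff_functional_analytic[OF c d, of n] coeff_functional_has_derivative[OF c d, of x n]
  show "banach_analytic (\<lambda>x. fourier_coeff (\<lambda>t. fn (fst x) t * fn (snd x) (- t)) n) phase_space"
    by (fact *(1))
  show "((\<lambda>x. fourier_coeff (\<lambda>t. fn (fst x) t * fn (snd x) (- t)) n) has_derivative
       (\<lambda>h. fourier_coeff (\<lambda>t. fn (fst h) t * fn (snd x) (- t) + fn (fst x) t * fn (snd h) (- t)) n)) (at x)"
    if "x \<in> phase_space"
    using *(2)[OF that] by (simp add: mult.commute)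
qed

text \<open>The coefficients of \<kappa>: index 0 gives the Hamiltonian, and positive indices enter
  the integrals.\<close>

definition energy_coeff :: "(real \<Rightarrow> complex) \<Rightarrow> int \<Rightarrow> H1p0 \<times> H1p0 \<Rightarrow> complex" where
  "energy_coeff f n x = fourier_coeff (\<lambda>t. fn (fst x) t * (fn (snd x) (- t))\<^sup>2 + f t / fn (fst x) t) n"

lemma
  assumes f: "f \<in> H1"
  shows energy_coeff_analytic: "banach_analytic (energy_coeff f n) phase_space"
    and energy_coeff_has_derivative: "x \<in> phase_space \<Longrightarrow>
      (energy_coeff f n has_derivative (\<lambda>h. fourier_coeff
        (\<lambda>t. ((fn (snd x) (- t))\<^sup>2 - f t / (fn (fst x) t)\<^sup>2) * fn (fst h) t
          + 2 * fn (fst x) t * fn (snd x) (- t) * fn (snd h) (- t)) n)) (at x)"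
proof -
  let ?S = "UNIV \<times> (- {0 :: complex}) \<times> UNIV :: (real \<times> complex \<times> complex) set"
  have cf: "continuous_on ?S (\<lambda>z. f (fst z))"
    by (rule continuous_on_compose2[OF H1_continuous[OF f]]) (auto intro!: continuous_intros)
  have c: "continuous_on ?S (\<lambda>(t, a, b). a * b\<^sup>2 + f t / a)"
      "continuous_on ?S (\<lambda>(t, a, b). b\<^sup>2 - f t / a\<^sup>2)"
      "continuous_on ?S (\<lambda>(t, a, b). 2 * a * b)"
    unfolding case_prod_beta' by (intro continuous_intros cf; auto)+
  have d: "((\<lambda>z. fst z * (snd z)\<^sup>2 + f t / fst z) has_derivative
      (\<lambda>z. (b\<^sup>2 - f t / a\<^sup>2) * fst z + 2 * a * b * snd z)) (at (a, b))" if "a \<noteq> 0" for t a b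
    using that
    by (auto intro!: derivative_eq_intros simp: fun_eq_iff field_simps power2_eq_square)
  note * = coeff_functional_analytic[where K = "\<lambda>t a b. a * b\<^sup>2 + f t / a", OF c d, of n]
    coeff_functional_has_derivative[where K = "\<lambda>t a b. a * b\<^sup>2 + f t / a", OF c d, of x n]
  show "banach_analytic (energy_coeff f n) phase_space"
    unfolding energy_coeff_def[abs_def] by (rule *(1)) assumption
  show "(energy_coeff f n has_derivative (\<lambda>h. fourier_coeff
        (\<lambda>t. ((fn (snd x) (- t))\<^sup>2 - f t / (fn (fst x) t)\<^sup>2) * fn (fst h) t
          + 2 * fn (fst x) t * fn (snd x) (- t) * fn (snd h) (- t)) n)) (at x)"
    if "x \<in> phase_space"
    unfolding energy_coeff_def[abs_def] by (rule *(2)[OF _ that]) assumption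
qed

section \<open>Gradients and brackets\<close>

lemma fn_supp: "fn w \<in> H1_supp {1..}"
  by (simp add: H1_supp_def fn_H1 fn_coeff)

lemma fn_reflect_supp: "(\<lambda>t. fn p (- t)) \<in> H1_supp {..- 1}"
  by (simp add: H1_supp_def H1_reflect fn_H1 fourier_coeff_reflect fn_coeff)

lemma phase_pointI:
  "f \<in> H1 \<Longrightarrow> x \<in> phase_space \<Longrightarrow> phase_point f (fn (fst x)) (\<lambda>t. fn (snd x) (- t))"
  by (unfold_locales) (auto simp: fn_supp fn_reflect_supp phase_space_def nonvanishing_def)

text \<open>Gradients represented by functions: the variation of \<open>w\<close> is tested directly
  and that of \<open>p\<close> after reflection. \<open>Y\<close> may have frequencies of both
  signs, whereas \<open>X\<close> is the gradient in \<open>p\<close> itself.\<close>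

definition has_phase_gradient ::
  "(H1p0 \<times> H1p0 \<Rightarrow> complex) \<Rightarrow> H1p0 \<times> H1p0 \<Rightarrow> (real \<Rightarrow> complex) \<Rightarrow> (real \<Rightarrow> complex) \<Rightarrow> bool" where
  "has_phase_gradient F x Y X \<longleftrightarrow> Y \<in> H1 \<and> X \<in> H1_supp {1..} \<and>
     (F has_derivative (\<lambda>h. fourier_coeff (\<lambda>t. Y t * fn (fst h) t) 0
        + fourier_coeff (\<lambda>t. X t * fn (snd h) (- t)) 0)) (at x)"

text \<open>Parseval turns both means into pairings of coefficients. Variations of \<open>w\<close>
  have positive frequencies and so detect only the negative ones of \<open>Y\<close>; the remaining
  gradient coefficients are set to 0 as the definition demands.\<close>

lemma
  assumes g: "has_phase_gradient F x Y X"
  shows has_gradient_w: "has_gradient_w F x (\<lambda>k. if k \<le> 0 then 0 else fourier_coeff Y (- k))"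
    and has_gradient_p: "has_gradient_p F x (fourier_coeff X)"
proof -
  let ?D = "\<lambda>h. fourier_coeff (\<lambda>t. Y t * fn (fst h) t) 0 + fourier_coeff (\<lambda>t. X t * fn (snd h) (- t)) 0"
  have Y: "Y \<in> H1" and X: "X \<in> H1_supp {1..}" and D: "(F has_derivative ?D) (at x)"
    using g by (auto simp: has_phase_gradient_def)
  have diff: "F differentiable (at x)" using D by (rule differentiableI)
  have fd: "frechet_derivative F (at x) = ?D" using frechet_derivative_at[OF D] by simp
  have z: "fn 0 t = 0" for t by (simp add: zero_H1p0.rep_eq)
  have w: "((\<lambda>k. (if k \<le> 0 then 0 else fourier_coeff Y (- k)) * fourier_coeff (fn h) k) has_sum ?D (h, 0)) UNIV" for h
  proof -
    have "((\<lambda>k. fourier_coeff (fn h) k * fourier_coeff Y (- k)) has_sum ?D (h, 0)) UNIV"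
      using has_sum_parseval[OF fn_H1 H1_continuous[OF Y], of h] by (simp add: z mult.commute)
    moreover have "fourier_coeff (fn h) k * fourier_coeff Y (- k)
        = (if k \<le> 0 then 0 else fourier_coeff Y (- k)) * fourier_coeff (fn h) k" for k
      by (simp add: fn_coeff)
    ultimately show ?thesis by simp
  qed
  have p: "((\<lambda>k. fourier_coeff X k * fourier_coeff (fn h) k) has_sum ?D (0, h)) UNIV" for h
    using has_sum_parseval[OF H1_supp_H1[OF X] H1_continuous[OF H1_reflect[OF fn_H1]], of h]
    by (simp add: z fourier_coeff_reflect fn_H1)
  show "has_gradient_w F x (\<lambda>k. if k \<le> 0 then 0 else fourier_coeff Y (- k))"
    unfolding has_gradient_w_def fd using diff w by simp
  show "has_gradient_p F x (fourier_coeff X)"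
    unfolding has_gradient_p_def fd using diff p H1_supp_coeff[OF X] by simp
qed

text \<open>As \<open>X\<close> and \<open>X'\<close> have positive frequencies only, truncating the
  coefficients of \<open>Y\<close> and \<open>Y'\<close> leaves the pairings unchanged. Parseval
  then makes the bracket a difference of two means.\<close>

lemma has_poisson_bracketI:
  assumes F: "has_phase_gradient F x Y X" and G: "has_phase_gradient G x Y' X'"
    and b: "fourier_coeff (\<lambda>t. X t * Y' t) 0 - fourier_coeff (\<lambda>t. Y t * X' t) 0 = b"
  shows "has_poisson_bracket F G x b"
proof -
  have X: "X \<in> H1_supp {1..}" "X' \<in> H1_supp {1..}" and Y: "Y \<in> H1" "Y' \<in> H1"
    using F G by (auto simp: has_phase_gradient_def)
  have s: "((\<lambda>k. fourier_coeff X k * (if k \<le> 0 then 0 else fourier_coeff Y (- k))) has_sum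
      fourier_coeff (\<lambda>t. X t * Y t) 0) UNIV" if "X \<in> H1_supp {1..}" "Y \<in> H1" for X Y
  proof -
    have "(\<lambda>k. fourier_coeff X k * (if k \<le> 0 then 0 else fourier_coeff Y (- k)))
        = (\<lambda>k. fourier_coeff X k * fourier_coeff Y (- k))"
      using H1_supp_coeff[OF that(1)] by auto
    then show ?thesis
      using has_sum_parseval[OF H1_supp_H1[OF that(1)] H1_continuous[OF that(2)]] by simp
  qed
  have t: "((\<lambda>k. (if k \<le> 0 then 0 else fourier_coeff Y (- k)) * fourier_coeff X' k) has_sum
      fourier_coeff (\<lambda>t. Y t * X' t) 0) UNIV"
    using s[OF X(2) Y(1)] by (simp only: mult.commute)
  show ?thesis
    unfolding has_poisson_bracket_def
    by (rule exI, rule exI, rule exI, rule exI, rule exI, rule exI,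
        rule conjI[OF has_gradient_w[OF F] conjI[OF has_gradient_p[OF F] conjI[OF has_gradient_w[OF G]
          conjI[OF has_gradient_p[OF G] conjI[OF s[OF X(1) Y(2)] conjI[OF t b[symmetric]]]]]]])
qed

section \<open>The Hamiltonian and its integrals\<close>

lemma shift_funpow: "(shift ^^ n) g = (\<lambda>y. mode (- int n) y * g y)"
proof (induction n)
  case (Suc n)
  have e: "- int (Suc n) = - int n + - 1" by simp
  have "mode (- int n) y * g y * cis (- (2 * pi * y)) = mode (- int n + - 1) y * g y" for y
    unfolding mode_mult[symmetric] by (simp add: mode_def)
  then have "shift (\<lambda>y. mode (- int n) y * g y) = (\<lambda>y. mode (- int (Suc n)) y * g y)"
    unfolding e shift_def by (rule ext)
  then show ?case by (simp only: Suc funpow.simps o_apply)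
qed simp

context
  fixes f :: "real \<Rightarrow> complex"
  assumes f: "f \<in> H1"
begin

lemma hamiltonian_eq:
  assumes x: "x \<in> phase_space"
  shows "hamiltonian f x = energy_coeff f 0 x"
proof -
  let ?W = "fn (fst x)" and ?P = "\<lambda>t. fn (snd x) (- t)"
  interpret phase_point f ?W ?P by (rule phase_pointI[OF f x])
  have p2: "(\<lambda>y. (fn (snd x) y)\<^sup>2) \<in> H1"
    unfolding power2_eq_square by (intro H1_mult fn_H1)
  \<comment> \<open>Reflecting the second factor converts the index \<open>k\<close> of the bilinear
    pairing into the index \<open>- k\<close> of Parseval.\<close>
  have "pairing ?W (\<lambda>y. (fn (snd x) y)\<^sup>2) = fourier_coeff (\<lambda>t. ?W t * (?P t)\<^sup>2) 0"
    unfolding pairing_def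
    by (rule infsumI) (use has_sum_parseval[OF WH H1_continuous[OF P2H]] fourier_coeff_reflect[OF p2] in simp)
  then show ?thesis
    by (simp add: hamiltonian_def case_prod_beta' energy_coeff_def fourier_coeff_H1_add H1_mult WH P2H H1_divide f W_nz
        fourier_coeff_0[of "\<lambda>y. f y / fn (fst x) y"])
qed

text \<open>The sums from \<open>I_k\<close> over \<open>W P^2\<close> and from the potential over
  \<open>f / W\<close> have the same shape and merge into coefficients of \<kappa>.\<close>

lemma integral_J_eq:
  assumes x: "x \<in> phase_space"
  shows "integral_J f k x =
    (\<Sum>i\<in>{1..<int k + 1}. fourier_coeff (\<lambda>t. fn (fst x) t * fn (snd x) (- t)) i
        * fourier_coeff (\<lambda>t. fn (fst x) t * fn (snd x) (- t)) (int k + 1 - i))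
    - (\<Sum>i\<in>{1..<int k + 1}. fourier_coeff (fn (fst x)) i * energy_coeff f (int k + 1 - i) x)"
proof -
  let ?m = "int k + 1"
  let ?W = "fn (fst x)" and ?P = "\<lambda>t. fn (snd x) (- t)"
  interpret phase_point f ?W ?P by (rule phase_pointI[OF f x])
  have fW: "(\<lambda>y. f y / ?W y) \<in> H1" by (intro H1_divide f WH W_nz)
  have u: "hankel ?W (fn (snd x)) = u"
    by (simp add: hankel_def proj_plus0_eq u_def)
  \<comment> \<open>The two products with the full shifts cancel, leaving the discarded parts. The
    power \<open>k + 1\<close> of the shift is the reason for \<open>m = k + 1\<close>.\<close>
  have A: "op_A k ?W u = (\<lambda>y. ?W y * \<alpha> ?m y - u y * \<psi> ?m y)"
    by (simp only: fun_eq_iff op_A_def shift_funpow of_nat_add of_nat_1 proj_plus_lowpass base_H1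
        \<alpha>_def \<psi>_def) (simp add: algebra_simps)
  have AH: "(\<lambda>y. ?W y * \<alpha> ?m y - u y * \<psi> ?m y) \<in> H1"
    by (intro H1_diff H1_mult base_H1 \<alpha>\<psi>_H1)
  have I: "integral_I k x = fourier_coeff (\<lambda>y. (?W y * \<alpha> ?m y - u y * \<psi> ?m y) * ?P y) 0"
    unfolding integral_I_def case_prod_beta' u A pairing_def
    by (rule infsumI)
      (use has_sum_parseval[OF AH H1_continuous[OF PH]] fourier_coeff_reflect[OF fn_H1] in simp)
  have U: "potential_U f k (fst x)
      = - (\<Sum>i\<in>{1..<?m}. fourier_coeff ?W i * fourier_coeff (\<lambda>y. f y / ?W y) (?m - i))"
    unfolding potential_U_def proj_plus0_eq fourier_coeff_mult_pos[OF W fproj_H1_supp[OF fW]]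
    by (simp add: fourier_coeff_fproj[OF fW])
  have "energy_coeff f n x = fourier_coeff (\<lambda>y. ?W y * (?P y)\<^sup>2) n + fourier_coeff (\<lambda>y. f y / ?W y) n" for n
    unfolding energy_coeff_def by (intro fourier_coeff_H1_add H1_mult WH P2H fW)
  then show ?thesis
    by (simp add: integral_J_def case_prod_beta' I U fourier_coeff_op_A_pairing distrib_left sum.distrib)
qed

lemma integral_J_analytic: "banach_analytic (integral_J f k) phase_space"
  by (rule banach_analytic_cong[OF _ integral_J_eq[symmetric]])
    (intro banach_analytic_diff banach_analytic_sum banach_analytic_mult coeff_w_analytic coeff_wp_analytic
      energy_coeff_analytic f open_phase_space finite_atLeastLessThan_int)

lemma hamiltonian_has_phase_gradient:
  assumes x: "x \<in> phase_space"
  defines "W \<equiv> fn (fst x)" and "P \<equiv> \<lambda>t. fn (snd x) (- t)"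
  shows "has_phase_gradient (hamiltonian f) x (phase_point.grad_w_H f W P) (phase_point.grad_p_H W P)"
proof -
  interpret phase_point f W P unfolding W_def P_def by (rule phase_pointI[OF f x])
  have grad_w_H_eq: "grad_w_H t = (fn (snd x) (- t))\<^sup>2 - f t / (fn (fst x) t)\<^sup>2" for t
    by (simp add: grad_w_H_def) (simp add: W_def P_def)
  have "(energy_coeff f 0 has_derivative (\<lambda>h. fourier_coeff (\<lambda>t. grad_w_H t * fn (fst h) t) 0
        + fourier_coeff (\<lambda>t. grad_p_H t * fn (snd h) (- t)) 0)) (at x)"
    using energy_coeff_has_derivative[OF f x, of 0]
    unfolding differential_H[OF fn_reflect_supp fn_H1, symmetric]
    unfolding grad_w_H_eq by (simp add: W_def P_def)
  \<comment> \<open>The two functions are known to agree on the phase space; its openness transfers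
    the derivative.\<close>
  then have "(hamiltonian f has_derivative (\<lambda>h. fourier_coeff (\<lambda>t. grad_w_H t * fn (fst h) t) 0
        + fourier_coeff (\<lambda>t. grad_p_H t * fn (snd h) (- t)) 0)) (at x)"
    by (rule has_derivative_transform_within_open[OF _ open_phase_space x hamiltonian_eq[symmetric]])
  then show ?thesis
    by (simp add: has_phase_gradient_def grad_w_H_H1 grad_p_H_supp)
qed

lemma integral_J_has_phase_gradient:
  assumes x: "x \<in> phase_space"
  defines "W \<equiv> fn (fst x)" and "P \<equiv> \<lambda>t. fn (snd x) (- t)"
  shows "has_phase_gradient (integral_J f k) x
    (phase_point.grad_w_J f W P (int k + 1)) (phase_point.grad_p_J W P (int k + 1))"
proof -
  let ?m = "int k + 1"
  interpret phase_point f W P unfolding W_def P_def by (rule phase_pointI[OF f x])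
  let ?J = "\<lambda>x. (\<Sum>i\<in>{1..<?m}. fourier_coeff (\<lambda>t. fn (fst x) t * fn (snd x) (- t)) i
        * fourier_coeff (\<lambda>t. fn (fst x) t * fn (snd x) (- t)) (?m - i))
    - (\<Sum>i\<in>{1..<?m}. fourier_coeff (fn (fst x)) i * energy_coeff f (?m - i) x)"
  have grad_w_H_eq: "grad_w_H t = (fn (snd x) (- t))\<^sup>2 - f t / (fn (fst x) t)\<^sup>2" for t
    by (simp add: grad_w_H_def) (simp add: W_def P_def)
  have "kap = (\<lambda>t. fn (fst x) t * (fn (snd x) (- t))\<^sup>2 + f t / fn (fst x) t)"
    by (simp add: fun_eq_iff kap_def) (simp add: W_def P_def)
  then have kap: "energy_coeff f n x = fourier_coeff kap n" for n
    by (simp add: energy_coeff_def)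
  note w = coeff_w_has_derivative[OF x] and wp = coeff_wp_has_derivative[OF x]
    and e = energy_coeff_has_derivative[OF f x]
  \<comment> \<open>The termwise product rule yields the left side of \<open>differential_J\<close>
    at \<open>(W, P)\<close>, so the claimed gradient form is rewritten into that sum.\<close>
  have "(?J has_derivative (\<lambda>h. fourier_coeff (\<lambda>y. grad_w_J ?m y * fn (fst h) y) 0
      + fourier_coeff (\<lambda>y. grad_p_J ?m y * fn (snd h) (- y)) 0)) (at x)"
    using has_derivative_diff[OF has_derivative_sum[where I = "{1..<?m}", OF has_derivative_mult[OF wp wp]]
        has_derivative_sum[where I = "{1..<?m}", OF has_derivative_mult[OF w e]]]
    unfolding differential_J[OF fn_supp fn_reflect_supp, symmetric]
    unfolding grad_w_H_eq kap[symmetric] by (simp only: W_def P_def)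
  then have "(integral_J f k has_derivative (\<lambda>h. fourier_coeff (\<lambda>y. grad_w_J ?m y * fn (fst h) y) 0
      + fourier_coeff (\<lambda>y. grad_p_J ?m y * fn (snd h) (- y)) 0)) (at x)"
    by (rule has_derivative_transform_within_open[OF _ open_phase_space x integral_J_eq[symmetric]])
  then show ?thesis
    by (simp add: has_phase_gradient_def grad_w_J_H1 grad_p_J_supp)
qed

end

theorem theorem2:
  fixes f :: "real \<Rightarrow> complex"
  assumes "f \<in> H1"
  shows "(\<forall>k\<ge>1. banach_analytic (integral_J f k) phase_space \<and>
            (\<forall>x\<in>phase_space. has_poisson_bracket (hamiltonian f) (integral_J f k) x 0)) \<and>
         (\<forall>k\<ge>1. \<forall>l\<ge>1. \<forall>x\<in>phase_space.
            has_poisson_bracket (integral_J f k) (integral_J f l) x 0)"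
proof (intro conjI allI impI ballI)
  show "banach_analytic (integral_J f k) phase_space" for k
    by (rule integral_J_analytic[OF assms])
  fix x assume x: "x \<in> phase_space"
  interpret phase_point f "fn (fst x)" "\<lambda>t. fn (snd x) (- t)" by (rule phase_pointI[OF assms x])
  show "has_poisson_bracket (hamiltonian f) (integral_J f k) x 0" for k
    by (rule has_poisson_bracketI[OF hamiltonian_has_phase_gradient[OF assms x]
          integral_J_has_phase_gradient[OF assms x] bracket_H_J])
  show "has_poisson_bracket (integral_J f k) (integral_J f l) x 0" for k l
    by (rule has_poisson_bracketI[OF integral_J_has_phase_gradient[OF assms x]
          integral_J_has_phase_gradient[OF assms x] bracket_J_J])
qed

end
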